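(* The space $\mathsf{Ring}$ of all (enumerated) associative rings does not have a generic ring.
   Context: Rings are associative and are not required to have a unit. $\mathsf{Ring}$ is the space of all tuples $(+,-,\cdot,0)$ consisting of three binary operations (addition, subtraction, multiplication) on $\omega$ and an element $0\in\omega$ which make $\omega$ an associative ring; it is a closed subspace of $(\omega^{\omega\times\omega})^3\times\omega$ with the product topology ($\omega$ discrete). A ring in $\mathsf{Ring}$ is generic if the set of all members of $\mathsf{Ring}$ isomorphic to it is comeagre in $\mathsf{Ring}$. *)

theory Defs
  imports "HOL-Analysis.Analysis"
begin

text \<open>Tuples (addition, subtraction, multiplication, zero) on the natural numbers.  Their type
  carries the product topology given by the library instances for \<open>nat\<close> (discrete), function
  types (pointwise convergence) and binary products.\<close>

type_synonym ring_struct =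
  "(nat \<times> nat \<Rightarrow> nat) \<times> (nat \<times> nat \<Rightarrow> nat) \<times> (nat \<times> nat \<Rightarrow> nat) \<times> nat"

text \<open>\<open>class.ring\<close> requires associativity of multiplication, but neither a unit nor commutativity
  of multiplication.  Its unary minus is not part of the tuple and is recovered as 0 - a.\<close>

definition Ring :: "ring_struct set" where
  "Ring = {(add, sub, mul, zero).
     class.ring (\<lambda>a b. add (a, b)) zero (\<lambda>a b. sub (a, b)) (\<lambda>a. sub (zero, a))
       (\<lambda>a b. mul (a, b))}"

lemma mem_Ring_iff:
  "(add, sub, mul, zero) \<in> Ring \<longleftrightarrow>
     (\<forall>a b c. add (add (a, b), c) = add (a, add (b, c))) \<and>
     (\<forall>a b. add (a, b) = add (b, a)) \<and>
     (\<forall>a. add (zero, a) = a) \<and>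
     (\<forall>a b. add (sub (a, b), b) = a) \<and>
     (\<forall>a b c. mul (mul (a, b), c) = mul (a, mul (b, c))) \<and>
     (\<forall>a b c. mul (add (a, b), c) = add (mul (a, c), mul (b, c))) \<and>
     (\<forall>a b c. mul (a, add (b, c)) = add (mul (a, b), mul (a, c)))"
  (is "?L \<longleftrightarrow> ?R")
proof -
  note defs = Ring_def class.ring_def class.semiring_def class.ab_semigroup_add_def
    class.semigroup_add_def class.ab_semigroup_add_axioms_def class.semigroup_mult_def
    class.semiring_axioms_def class.ab_group_add_def class.comm_monoid_add_def
    class.comm_monoid_add_axioms_def class.ab_group_add_axioms_def
  show ?thesis
  proof
    assume L: ?L
    then have assoc: "add (add (a, b), c) = add (a, add (b, c))"
      and comm: "add (a, b) = add (b, a)" and unit: "add (zero, a) = a"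
      and neg: "add (sub (zero, a), a) = zero"
      and diff: "sub (a, b) = add (a, sub (zero, b))" for a b c
      unfolding defs by blast+
    have "add (sub (a, b), b) = a" for a b
      by (metis assoc comm unit neg diff)
    with L show ?R
      unfolding defs by blast
  next
    assume R: ?R
    then have assoc: "add (add (a, b), c) = add (a, add (b, c))"
      and comm: "add (a, b) = add (b, a)" and unit: "add (zero, a) = a"
      and sub: "add (sub (a, b), b) = a" for a b c
      by blast+
    have "sub (a, b) = add (a, sub (zero, b))" for a b
    proof -
      have "add (a, sub (zero, b)) = add (sub (a, b), add (b, sub (zero, b)))"
        by (metis assoc sub)
      also have "\<dots> = sub (a, b)"
        by (metis comm sub unit)
      finally show ?thesis by simp
    qed
    with R show ?L
      unfolding defs by blast
  qed
qed

definition ring_space :: "ring_struct topology" where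
  "ring_space = top_of_set Ring"

fun isomorphic :: "ring_struct \<Rightarrow> ring_struct \<Rightarrow> bool" where
  "isomorphic (add, sub, mul, zero) (add', sub', mul', zero') \<longleftrightarrow>
     (\<exists>f. bij f \<and>
       (\<forall>a b. f (add (a, b)) = add' (f a, f b)) \<and>
       (\<forall>a b. f (sub (a, b)) = sub' (f a, f b)) \<and>
       (\<forall>a b. f (mul (a, b)) = mul' (f a, f b)) \<and>
       f zero = zero')"

definition nowhere_dense_in :: "'a topology \<Rightarrow> 'a set \<Rightarrow> bool" where
  "nowhere_dense_in X S \<longleftrightarrow> S \<subseteq> topspace X \<and> X interior_of (X closure_of S) = {}"

definition meagre_in :: "'a topology \<Rightarrow> 'a set \<Rightarrow> bool" where
  "meagre_in X S \<longleftrightarrow> (\<exists>N :: nat \<Rightarrow> 'a set. (\<forall>n. nowhere_dense_in X (N n)) \<and> S = (\<Union>n. N n))"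

definition comeagre_in :: "'a topology \<Rightarrow> 'a set \<Rightarrow> bool" where
  "comeagre_in X S \<longleftrightarrow> S \<subseteq> topspace X \<and> meagre_in X (topspace X - S)"

definition generic_ring :: "ring_struct \<Rightarrow> bool" where
  "generic_ring R \<longleftrightarrow> R \<in> Ring \<and> comeagre_in ring_space {S \<in> Ring. isomorphic R S}"

end

theory Submission
  imports Defs "HOL-Library.Nat_Bijection"
begin

text \<open>Suppose that the isomorphism class \<open>C\<close> of a ring \<open>R\<close> is comeagre.  Take any condition on finitely many
elements that is expressed by finitely many equations and inequations and is satisfied in some ring.
By the Baire category theorem a member of \<open>C\<close>, hence \<open>R\<close> itself, contains elements satisfying it; then so does
every member of \<open>C\<close>, and the same polynomial expressions in these elements vanish there as in \<open>R\<close>.  There are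
countably many tuples of natural numbers, and for each of them the rings in which it has all these properties
form a closed set.  A second use of Baire's theorem yields one tuple \<open>z\<close> and a finite list \<open>E\<close> of
equations between natural numbers, satisfied by some ring, such that in all rings satisfying \<open>E\<close> the tuple \<open>z\<close>
fulfils the condition and each of the expressions in question either vanishes in all of them or in none.  So
the finite list \<open>E\<close> decides which expressions vanish.

The contradiction comes from a condition whose consequences are too rich to be decided in this way.  The
generators of the ring are made to multiply like the instructions of a stack machine: the product along a word
of instructions simulates running it, and only two ring equations per instruction are needed
(\<open>simulates\<close>, \<open>exec_word_value\<close>).  The condition is satisfiable, because instructions are partial functions
on stacks and these act on the additive group of integer-valued functions on stacks
(\<open>ring_simulating_all_instrs\<close>).  The machine computes everything computable, so one of its programs can work as
in Rosser's version of the incompleteness theorem.  Given a code of the list \<open>E\<close> and of the names in \<open>z\<close>, the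
program searches through all equational derivations.  It is arranged that the product which represents this very
run, the \<open>probe\<close>, equals the identity element \<open>e\<close> of the simulation (which is nonzero) if a derivation of
\<open>probe = 0\<close> from \<open>E\<close> is found, and equals \<open>0\<close> if a derivation is found which shows that \<open>E\<close> together with
\<open>probe = 0\<close> identifies two different numbers.  Either outcome is impossible in a ring that satisfies \<open>E\<close>, so
neither derivation exists (\<open>rosser_instr\<close>).  By completeness of equational logic there are then rings
satisfying \<open>E\<close> in which the probe vanishes and others in which it does not (\<open>undecided_probe\<close>), contrary to
the choice of \<open>E\<close>.\<close>

section \<open>Equational logic of rings and quotients of the term algebra\<close>

text \<open>The variables double as names: \<open>Var i\<close> denotes the element \<open>i\<close> of an enumerated ring, so that a finite list of
equations between such terms is a finite piece of information about the enumeration.\<close>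

datatype trm = Var nat | Add trm trm | Sub trm trm | Mul trm trm

instance trm :: countable by countable_datatype

text \<open>With a difference of equal elements at hand the language does without a symbol for zero.\<close>

definition Zero :: trm where "Zero = Sub (Var 0) (Var 0)"

definition ring_axioms :: "trm \<Rightarrow> trm \<Rightarrow> trm \<Rightarrow> (trm \<times> trm) list" where
  "ring_axioms a b c =
    [(Add (Add a b) c, Add a (Add b c)),
     (Add a b, Add b a),
     (Add Zero a, a),
     (Add (Sub a b) b, a),
     (Mul (Mul a b) c, Mul a (Mul b c)),
     (Mul (Add a b) c, Add (Mul a c) (Mul b c)),
     (Mul a (Add b c), Add (Mul a b) (Mul a c)),
     (a, a)]"

text \<open>The rules for transitivity and symmetry, and compatibility with the three operations.  Where transitivity does not
apply, the first premise is repeated; thus an inference is possible from any two equations, and a list of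
inferences is never malformed.\<close>

fun consequences :: "trm \<times> trm \<Rightarrow> trm \<times> trm \<Rightarrow> (trm \<times> trm) list" where
  "consequences (s, t) (u, v) =
    [(t, s), (if t = u then (s, v) else (s, t)),
     (Add s u, Add t v), (Sub s u, Sub t v), (Mul s u, Mul t v)]"

definition ring_congruence :: "(trm \<times> trm) set \<Rightarrow> bool" where
  "ring_congruence r \<longleftrightarrow>
     (\<forall>a b c. set (ring_axioms a b c) \<subseteq> r) \<and>
     (\<forall>d\<in>r. \<forall>d'\<in>r. set (consequences d d') \<subseteq> r)"

text \<open>The least ring congruence that contains \<open>E\<close>: equational provability from \<open>E\<close>.\<close>

inductive_set Th :: "(trm \<times> trm) set \<Rightarrow> (trm \<times> trm) set" for E where
  hyp: "d \<in> E \<Longrightarrow> d \<in> Th E"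
| ax: "d \<in> set (ring_axioms a b c) \<Longrightarrow> d \<in> Th E"
| infer: "d \<in> Th E \<Longrightarrow> d' \<in> Th E \<Longrightarrow> d'' \<in> set (consequences d d') \<Longrightarrow> d'' \<in> Th E"

lemma ring_congruence_Th: "ring_congruence (Th E)"
  unfolding ring_congruence_def using Th.ax Th.infer by blast

lemma Th_least: "E \<subseteq> r \<Longrightarrow> ring_congruence r \<Longrightarrow> Th E \<subseteq> r"
proof
  fix d assume "d \<in> Th E" and "E \<subseteq> r" "ring_congruence r"
  then show "d \<in> r"
    by (induction rule: Th.induct) (unfold ring_congruence_def, blast+)
qed

lemma ring_congruence_Int:
  "ring_congruence r \<Longrightarrow> ring_congruence r' \<Longrightarrow> ring_congruence (r \<inter> r')"
  unfolding ring_congruence_def by blast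

lemma ring_congruenceD:
  assumes "ring_congruence r"
  shows "(a, a) \<in> r"
    and "(s, t) \<in> r \<Longrightarrow> (t, s) \<in> r"
    and "(s, t) \<in> r \<Longrightarrow> (t, u) \<in> r \<Longrightarrow> (s, u) \<in> r"
    and "(s, t) \<in> r \<Longrightarrow> (u, v) \<in> r \<Longrightarrow> (Add s u, Add t v) \<in> r"
    and "(s, t) \<in> r \<Longrightarrow> (u, v) \<in> r \<Longrightarrow> (Sub s u, Sub t v) \<in> r"
    and "(s, t) \<in> r \<Longrightarrow> (u, v) \<in> r \<Longrightarrow> (Mul s u, Mul t v) \<in> r"
proof -
  have ax: "set (ring_axioms a b c) \<subseteq> r" for a b c
    using assms unfolding ring_congruence_def by blast
  have co: "set (consequences d d') \<subseteq> r" if "d \<in> r" "d' \<in> r" for d d'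
    using assms that unfolding ring_congruence_def by blast
  show "(a, a) \<in> r" using ax[of a] by (simp add: ring_axioms_def)
  show "(s, t) \<in> r \<Longrightarrow> (t, s) \<in> r" using co[of "(s, t)" "(s, t)"] by simp
  show "(s, t) \<in> r \<Longrightarrow> (t, u) \<in> r \<Longrightarrow> (s, u) \<in> r"
    using co[of "(s, t)" "(t, u)"] by simp
  show "(s, t) \<in> r \<Longrightarrow> (u, v) \<in> r \<Longrightarrow> (Add s u, Add t v) \<in> r"
    and "(s, t) \<in> r \<Longrightarrow> (u, v) \<in> r \<Longrightarrow> (Sub s u, Sub t v) \<in> r"
    and "(s, t) \<in> r \<Longrightarrow> (u, v) \<in> r \<Longrightarrow> (Mul s u, Mul t v) \<in> r"
    using co[of "(s, t)" "(u, v)"] by simp_all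
qed

abbreviation radd :: "ring_struct \<Rightarrow> nat \<times> nat \<Rightarrow> nat" where "radd S \<equiv> fst S"
abbreviation rsub :: "ring_struct \<Rightarrow> nat \<times> nat \<Rightarrow> nat" where "rsub S \<equiv> fst (snd S)"
abbreviation rmul :: "ring_struct \<Rightarrow> nat \<times> nat \<Rightarrow> nat" where "rmul S \<equiv> fst (snd (snd S))"
abbreviation rzero :: "ring_struct \<Rightarrow> nat" where "rzero S \<equiv> snd (snd (snd S))"

lemma RingD:
  assumes "S \<in> Ring"
  shows "radd S (radd S (a, b), c) = radd S (a, radd S (b, c))"
    and "radd S (a, b) = radd S (b, a)"
    and "radd S (rzero S, a) = a"
    and "radd S (rsub S (a, b), b) = a"
    and "rmul S (rmul S (a, b), c) = rmul S (a, rmul S (b, c))"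
    and "rmul S (radd S (a, b), c) = radd S (rmul S (a, c), rmul S (b, c))"
    and "rmul S (a, radd S (b, c)) = radd S (rmul S (a, b), rmul S (a, c))"
  using assms by (cases S, simp add: mem_Ring_iff; blast)+

lemma rsub_self: "rsub S (a, a) = rzero S" if "S \<in> Ring"
proof -
  have "radd S (radd S (rsub S (a, a), a), rsub S (rzero S, a)) = rsub S (a, a)"
    by (metis RingD(1,2,3,4)[OF that])
  then show ?thesis by (metis RingD(2,4)[OF that])
qed

fun eval :: "ring_struct \<Rightarrow> trm \<Rightarrow> nat" where
  "eval S (Var i) = i"
| "eval S (Add s t) = radd S (eval S s, eval S t)"
| "eval S (Sub s t) = rsub S (eval S s, eval S t)"
| "eval S (Mul s t) = rmul S (eval S s, eval S t)"

lemma ring_congruence_eval: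
  assumes "S \<in> Ring"
  shows "ring_congruence {(s, t). eval S s = eval S t}"
proof -
  have "set (ring_axioms a b c) \<subseteq> {(s, t). eval S s = eval S t}" for a b c
    by (simp add: ring_axioms_def Zero_def rsub_self[OF assms] RingD(1,3,4,5,6,7)[OF assms])
      (rule RingD(2)[OF assms])
  then show ?thesis
    unfolding ring_congruence_def by (auto split: if_splits)
qed

lemma Th_sound:
  assumes "S \<in> Ring" "\<forall>(s, t)\<in>E. eval S s = eval S t" "(s, t) \<in> Th E"
  shows "eval S s = eval S t"
  using Th_least[OF _ ring_congruence_eval[OF assms(1)], of E] assms(2,3) by auto

lemma eval_Zero: "S \<in> Ring \<Longrightarrow> eval S Zero = rzero S"
  by (simp add: Zero_def rsub_self)

fun vars :: "trm \<Rightarrow> nat set" where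
  "vars (Var i) = {i}"
| "vars (Add s t) = vars s \<union> vars t"
| "vars (Sub s t) = vars s \<union> vars t"
| "vars (Mul s t) = vars s \<union> vars t"

lemma finite_vars: "finite (vars t)"
  by (induction t) auto

text \<open>Map the rest of the set onto the complement of the prescribed values: both are countably infinite.\<close>

lemma extend_finite_enumeration:
  fixes f :: "'a \<Rightarrow> nat"
  assumes "countable Q" "infinite Q" "finite D" "D \<subseteq> Q" "inj_on f D"
  obtains g where "bij_betw g Q (UNIV :: nat set)" "\<And>x. x \<in> D \<Longrightarrow> g x = f x"
proof -
  have "infinite (Q - D)" "countable (Q - D)" using assms by auto
  then have 1: "bij_betw (to_nat_on (Q - D)) (Q - D) UNIV" by (rule to_nat_on_infinite[rotated])
  have "infinite (- f ` D)" using assms(3) by (simp add: Compl_eq_Diff_UNIV)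
  then have 2: "bij_betw (from_nat_into (- f ` D)) UNIV (- f ` D)"
    by (intro bij_betw_from_nat_into) auto
  define g where "g x = (if x \<in> D then f x else from_nat_into (- f ` D) (to_nat_on (Q - D) x))" for x
  have "bij_betw g D (f ` D)" using assms(5)
    by (simp add: g_def bij_betw_def inj_on_def)
  moreover have "bij_betw g (Q - D) (- f ` D)"
    using bij_betw_trans[OF 1 2] by (rule bij_betw_cong[THEN iffD1, rotated]) (auto simp: g_def)
  ultimately have "bij_betw g (D \<union> (Q - D)) (f ` D \<union> - f ` D)"
    by (rule bij_betw_combine) auto
  moreover have "D \<union> (Q - D) = Q" using assms(4) by auto
  ultimately have "bij_betw g Q UNIV" by simp
  then show thesis by (rule that) (simp add: g_def)
qed

text \<open>Completeness of equational logic in the form that is needed for enumerated rings.  The quotient of the term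
algebra is a countably infinite ring; its enumeration by natural numbers is chosen such that the finitely many
constants in \<open>F\<close> denote the numbers that they name.\<close>

lemma quotient_ring:
  assumes r: "ring_congruence r"
    and X: "infinite X" "\<And>s t. s \<in> X \<Longrightarrow> t \<in> X \<Longrightarrow> (s, t) \<in> r \<Longrightarrow> s = t"
    and F: "finite F" "\<And>i j. i \<in> F \<Longrightarrow> j \<in> F \<Longrightarrow> (Var i, Var j) \<in> r \<Longrightarrow> i = j"
  obtains S h where "S \<in> Ring" "\<And>s t. h s = h t \<longleftrightarrow> (s, t) \<in> r"
    "\<And>s t. h (Add s t) = radd S (h s, h t)"
    "\<And>s t. h (Sub s t) = rsub S (h s, h t)"
    "\<And>s t. h (Mul s t) = rmul S (h s, h t)"
    "h Zero = rzero S"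
    "\<And>i. i \<in> F \<Longrightarrow> h (Var i) = i"
proof -
  note D = ring_congruenceD[OF r]
  define cl where "cl s = r `` {s}" for s
  have cl: "cl s = cl t \<longleftrightarrow> (s, t) \<in> r" for s t
    unfolding cl_def using D(1,2,3) by blast
  have "inj_on cl X" using X(2) cl by (auto simp: inj_on_def)
  then have inf: "infinite (range cl)"
    using X(1) by (meson finite_imageD finite_subset image_mono subset_UNIV)
  have injV: "inj_on (\<lambda>i. cl (Var i)) F" using F(2) cl by (auto simp: inj_on_def)
  \<comment> \<open>The class of \<open>Var i\<close> has to receive the number \<open>i\<close>.\<close>
  define f where "f = the_inv_into F (\<lambda>i. cl (Var i))"
  have "bij_betw (\<lambda>i. cl (Var i)) F ((\<lambda>i. cl (Var i)) ` F)" using injV by (simp add: bij_betw_def)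
  then have "inj_on f ((\<lambda>i. cl (Var i)) ` F)"
    unfolding f_def by (intro bij_betw_imp_inj_on[OF bij_betw_the_inv_into])
  with inf F(1) obtain g where g: "bij_betw g (range cl) (UNIV :: nat set)"
    "\<And>x. x \<in> (\<lambda>i. cl (Var i)) ` F \<Longrightarrow> g x = f x"
    by (rule_tac extend_finite_enumeration[of "range cl" "(\<lambda>i. cl (Var i)) ` F" f]) auto
  define h where "h s = g (cl s)" for s
  have h: "h s = h t \<longleftrightarrow> (s, t) \<in> r" for s t
    unfolding h_def cl[symmetric] using g(1)
    by (metis bij_betw_imp_inj_on inj_onD rangeI)
  have hV: "h (Var i) = i" if "i \<in> F" for i
    using that g(2) unfolding h_def f_def by (simp add: the_inv_into_f_f[OF injV])
  have "surj h" using g(1) by (auto simp: h_def bij_betw_def image_image)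
  define k where "k = inv h"
  have hk: "h (k a) = a" for a unfolding k_def using \<open>surj h\<close> by (simp add: surj_f_inv_f)
  have kh: "(k (h s), s) \<in> r" for s using h hk by blast
  define S :: ring_struct where "S = ((\<lambda>(a, b). h (Add (k a) (k b))), (\<lambda>(a, b). h (Sub (k a) (k b))),
    (\<lambda>(a, b). h (Mul (k a) (k b))), h Zero)"
  have ops: "h (Add s t) = radd S (h s, h t)" "h (Sub s t) = rsub S (h s, h t)"
    "h (Mul s t) = rmul S (h s, h t)" "h Zero = rzero S" for s t
    using D(4)[OF kh kh, of s t] D(5)[OF kh kh, of s t] D(6)[OF kh kh, of s t]
    by (auto simp: S_def h dest: D(2))
  have "(s, t) \<in> r" if "(s, t) \<in> set (ring_axioms a b c)" for a b c s t
    using r that unfolding ring_congruence_def by blast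
  then have hax: "h s = h t" if "(s, t) \<in> set (ring_axioms a b c)" for a b c s t
    using h that by blast
  have laws: "radd S (radd S (h s, h t), h u) = radd S (h s, radd S (h t, h u))"
    "radd S (h s, h t) = radd S (h t, h s)" "radd S (rzero S, h s) = h s"
    "radd S (rsub S (h s, h t), h t) = h s"
    "rmul S (rmul S (h s, h t), h u) = rmul S (h s, rmul S (h t, h u))"
    "rmul S (radd S (h s, h t), h u) = radd S (rmul S (h s, h u), rmul S (h t, h u))"
    "rmul S (h s, radd S (h t, h u)) = radd S (rmul S (h s, h t), rmul S (h s, h u))" for s t u
    unfolding ops[symmetric] by (rule hax[of _ _ s t u]; simp add: ring_axioms_def)+
  have "S \<in> Ring"
  proof -
    have all_h: "(\<forall>a. P a) \<longleftrightarrow> (\<forall>s. P (h s))" for P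
      using \<open>surj h\<close> by (metis surjD)
    show ?thesis
      using laws by (cases S) (simp add: mem_Ring_iff all_h)
  qed
  with h ops hV that show thesis by blast
qed

section \<open>A stack machine inside a ring\<close>

text \<open>A machine working on a stack of natural numbers.  \<open>Under w\<close> runs \<open>w\<close> below the top entry, \<open>Iter w\<close> removes the
top entry \<open>n\<close> and runs \<open>w\<close> \<open>n\<close> times, \<open>Branch u v\<close> removes a zero and runs \<open>u\<close> or replaces \<open>n + 1\<close> by \<open>n\<close> and runs
\<open>v\<close>, and \<open>While w\<close> runs \<open>w\<close> as long as the top entry is nonzero.  \<open>Fail\<close> has no successful run.  Since a number \<open>n\<close>
is produced by \<open>Push\<close> followed by \<open>n\<close> times \<open>Inc\<close>, an instruction that inspects the top entry is
determined by what it does after a \<open>Push\<close> and after an \<open>Inc\<close>; these two words are \<open>on_zero\<close> and \<open>on_suc\<close>.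
Each of the control structures is thereby specified by two equations between words.\<close>

datatype instr = Inc | Push | Fail
  | Under "instr list" | Iter "instr list" | Branch "instr list" "instr list" | While "instr list"

instance instr :: countable by countable_datatype

fun branching :: "instr \<Rightarrow> bool" where
  "branching Inc = False" | "branching Push = False" | "branching Fail = False"
| "branching _ = True"

fun on_zero :: "instr \<Rightarrow> instr list" where
  "on_zero (Under w) = w @ [Push]"
| "on_zero (Iter w) = []"
| "on_zero (Branch u v) = u"
| "on_zero (While w) = [Push]"
| "on_zero _ = []"

text \<open>In the clause for \<open>Branch\<close> the instruction \<open>Under []\<close> leaves a nonempty stack unchanged and has no run
on the empty one.  It ensures that \<open>Inc\<close> followed by \<open>L\<close> is the same partial function as \<open>on_suc L\<close> on all
stacks, see \<open>exec_on_suc_Nil\<close>.\<close>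

fun on_suc :: "instr \<Rightarrow> instr list" where
  "on_suc (Under w) = [Under w, Inc]"
| "on_suc (Iter w) = Iter w # w"
| "on_suc (Branch u v) = Under [] # v"
| "on_suc (While w) = Inc # w @ [While w]"
| "on_suc _ = []"

text \<open>The head of the list is the top of the stack.\<close>

inductive exec :: "instr list \<Rightarrow> nat list \<Rightarrow> nat list \<Rightarrow> bool" where
  halt: "exec [] xs xs"
| inc: "exec w (Suc n # xs) ys \<Longrightarrow> exec (Inc # w) (n # xs) ys"
| push: "exec w (0 # xs) ys \<Longrightarrow> exec (Push # w) xs ys"
| zero: "branching L \<Longrightarrow> exec (on_zero L @ w) xs ys \<Longrightarrow> exec (L # w) (0 # xs) ys"
| suc: "branching L \<Longrightarrow> exec (on_suc L @ w) (n # xs) ys \<Longrightarrow> exec (L # w) (Suc n # xs) ys"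

inductive_cases exec_NilE: "exec [] xs ys"
inductive_cases exec_ConsE: "exec (L # w) xs ys"

lemma exec_Nil [simp]: "exec [] xs ys \<longleftrightarrow> xs = ys"
  by (auto elim: exec_NilE intro: halt)

lemma exec_Inc [simp]: "exec (Inc # w) xs ys \<longleftrightarrow> (\<exists>n zs. xs = n # zs \<and> exec w (Suc n # zs) ys)"
  by (auto elim: exec_ConsE intro: inc)

lemma exec_Push [simp]: "exec (Push # w) xs ys \<longleftrightarrow> exec w (0 # xs) ys"
  by (auto elim: exec_ConsE intro: push)

lemma exec_Fail [simp]: "\<not> exec (Fail # w) xs ys"
  by (auto elim: exec_ConsE)

lemma exec_branching:
  assumes "branching L"
  shows "exec (L # w) [] ys \<longleftrightarrow> False"
    and "exec (L # w) (0 # xs) ys \<longleftrightarrow> exec (on_zero L @ w) xs ys"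
    and "exec (L # w) (Suc n # xs) ys \<longleftrightarrow> exec (on_suc L @ w) (n # xs) ys"
  using assms by (auto elim: exec_ConsE intro: exec.intros)

lemma exec_deterministic: "exec w xs ys \<Longrightarrow> exec w xs zs \<Longrightarrow> ys = zs"
  by (induction rule: exec.induct) (auto simp: exec_branching)

lemma exec_append: "exec u xs ys \<Longrightarrow> exec v ys zs \<Longrightarrow> exec (u @ v) xs zs"
  by (induction rule: exec.induct) (auto simp: exec_branching)

lemma exec_append_iff: "exec (u @ v) xs zs \<longleftrightarrow> (\<exists>ys. exec u xs ys \<and> exec v ys zs)"
proof
  assume "exec (u @ v) xs zs"
  then show "\<exists>ys. exec u xs ys \<and> exec v ys zs"
  proof (induction "u @ v" xs zs arbitrary: u rule: exec.induct)
    case (zero L w xs ys)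
    show ?case
    proof (cases u)
      case Nil
      then show ?thesis using zero.hyps exec.zero[of L w] by auto
    next
      case (Cons M u')
      with zero.hyps(4) have "on_zero L @ w = (on_zero L @ u') @ v" by simp
      from zero.hyps(3)[OF this] Cons zero.hyps(1,4) show ?thesis
        by (auto intro: exec.zero)
    qed
  next
    case (suc L w n xs ys)
    show ?case
    proof (cases u)
      case Nil
      then show ?thesis using suc.hyps exec.suc[of L w] by auto
    next
      case (Cons M u')
      with suc.hyps(4) have "on_suc L @ w = (on_suc L @ u') @ v" by simp
      from suc.hyps(3)[OF this] Cons suc.hyps(1,4) show ?thesis
        by (auto intro: exec.suc)
    qed
  qed (auto simp: Cons_eq_append_conv)
qed (blast intro: exec_append)

lemma exec_on_suc_Nil: "branching L \<Longrightarrow> \<not> exec (on_suc L) [] ys"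
  by (cases L) (auto simp: exec_branching)

lemma exec_Under: "exec w xs ys \<Longrightarrow> exec [Under w] (n # xs) (n # ys)"
proof (induction n)
  case 0
  then show ?case by (simp add: exec_branching exec_append)
next
  case (Suc n)
  then have "exec ([Under w] @ [Inc]) (n # xs) (Suc n # ys)"
    by (intro exec_append[of _ _ "n # ys"]) auto
  then show ?case by (simp add: exec_branching)
qed

lemma exec_Iter: "(\<And>i. i < n \<Longrightarrow> exec w (xs i) (xs (Suc i))) \<Longrightarrow> exec [Iter w] (n # xs 0) (xs n)"
proof (induction n)
  case (Suc n)
  then have "exec ([Iter w] @ w) (n # xs 0) (xs (Suc n))"
    by (intro exec_append[of _ _ "xs n"]) auto
  then show ?case by (simp add: exec_branching)
qed (simp add: exec_branching)

lemma exec_Branch: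
  "exec u xs ys \<Longrightarrow> exec [Branch u v] (0 # xs) ys"
  "exec v (n # xs) ys \<Longrightarrow> exec [Branch u v] (Suc n # xs) ys"
proof -
  show "exec u xs ys \<Longrightarrow> exec [Branch u v] (0 # xs) ys" by (simp add: exec_branching)
  assume "exec v (n # xs) ys"
  then have "exec ([Under []] @ v) (n # xs) ys"
    by (intro exec_append[of _ _ "n # xs"] exec_Under) auto
  then show "exec [Branch u v] (Suc n # xs) ys" by (simp add: exec_branching)
qed

lemma exec_While:
  "exec [While w] (0 # xs) (0 # xs)"
  "exec w (Suc n # xs) ys \<Longrightarrow> exec [While w] ys zs \<Longrightarrow> exec [While w] (Suc n # xs) zs"
  by (simp_all add: exec_branching exec_append)

text \<open>The product of the elements assigned to the instructions.  As a ring need not have a unit, an element \<open>e\<close>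
represents the empty word.\<close>

definition word_value :: "ring_struct \<Rightarrow> nat \<Rightarrow> (instr \<Rightarrow> nat) \<Rightarrow> instr list \<Rightarrow> nat" where
  "word_value S e x w = foldl (\<lambda>a L. rmul S (a, x L)) e w"

text \<open>The finitely many equations and the one inequation (if \<open>Ls\<close> is finite) that make the products of the elements
\<open>x L\<close> behave like runs of the machine.\<close>

definition simulates :: "instr set \<Rightarrow> ring_struct \<Rightarrow> nat \<Rightarrow> (instr \<Rightarrow> nat) \<Rightarrow> bool" where
  "simulates Ls S e x \<longleftrightarrow>
     e \<noteq> rzero S \<and> rmul S (e, e) = e \<and>
     (\<forall>L\<in>Ls. rmul S (e, x L) = x L \<and> rmul S (x L, e) = x L) \<and>
     (\<forall>L\<in>Ls. branching L \<longrightarrow>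
        rmul S (x Push, x L) = word_value S e x (on_zero L) \<and>
        rmul S (x Inc, x L) = word_value S e x (on_suc L)) \<and>
     x Fail = rzero S"

text \<open>The sets of instructions that are never left by unfolding an instruction to \<open>on_zero\<close> or \<open>on_suc\<close>.\<close>

definition closed_instrs :: "instr set \<Rightarrow> bool" where
  "closed_instrs Ls \<longleftrightarrow> {Inc, Push, Fail} \<subseteq> Ls \<and>
     (\<forall>L\<in>Ls. set (on_zero L) \<subseteq> Ls \<and> set (on_suc L) \<subseteq> Ls)"

primrec sub_instrs :: "instr \<Rightarrow> instr set" where
  "sub_instrs Inc = {Inc}"
| "sub_instrs Push = {Push}"
| "sub_instrs Fail = {Fail}"
| "sub_instrs (Under w) = insert (Under w) (\<Union> (set (map sub_instrs w)))"
| "sub_instrs (Iter w) = insert (Iter w) (\<Union> (set (map sub_instrs w)))"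
| "sub_instrs (Branch u v) = insert (Branch u v) (\<Union> (set (map sub_instrs u)) \<union> \<Union> (set (map sub_instrs v)))"
| "sub_instrs (While w) = insert (While w) (\<Union> (set (map sub_instrs w)))"

lemma self_sub_instrs: "L \<in> sub_instrs L" by (cases L) auto

lemma finite_sub_instrs: "finite (sub_instrs L)"
  by (induction L) auto

lemma sub_instrs_trans: "M \<in> sub_instrs L \<Longrightarrow> sub_instrs M \<subseteq> sub_instrs L"
proof (induction L)
  case (Branch u v)
  then have "M = Branch u v \<or> (\<exists>K \<in> set u \<union> set v. M \<in> sub_instrs K \<and> sub_instrs M \<subseteq> sub_instrs K)"
    by (simp add: bex_Un) blast
  then show ?case by (rule disjE) (simp, auto)
qed auto

lemma sub_instrs_rhs:
  "set (on_zero L) \<subseteq> sub_instrs L \<union> {Push}"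
  "set (on_suc L) \<subseteq> sub_instrs L \<union> {Inc, Under []}"
proof -
  have 1: "set w \<subseteq> \<Union> (set (map sub_instrs w))" for w
    using self_sub_instrs by force
  show "set (on_zero L) \<subseteq> sub_instrs L \<union> {Push}"
  proof (cases L)
    case (Under w) with 1[of w] show ?thesis by simp blast
  next
    case (Branch u v) with 1[of u] show ?thesis by simp blast
  qed simp_all
  show "set (on_suc L) \<subseteq> sub_instrs L \<union> {Inc, Under []}"
  proof (cases L)
    case (Iter w) with 1[of w] show ?thesis by simp blast
  next
    case (While w) with 1[of w] show ?thesis by simp blast
  next
    case (Branch u v) with 1[of v] show ?thesis by simp blast
  qed simp_all
qed

text \<open>Only finitely many equations are relevant for the runs of one program.\<close>

definition instrs_of :: "instr \<Rightarrow> instr set" where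
  "instrs_of L = sub_instrs L \<union> {Inc, Push, Fail, Under []}"

lemma finite_instrs_of: "finite (instrs_of L)"
  by (simp add: instrs_of_def finite_sub_instrs)

lemma closed_instrs_of: "closed_instrs (instrs_of L)"
proof -
  have "set (on_zero M) \<subseteq> instrs_of L \<and> set (on_suc M) \<subseteq> instrs_of L" if "M \<in> instrs_of L" for M
  proof (cases "M \<in> sub_instrs L")
    case True
    from sub_instrs_rhs[of M] sub_instrs_trans[OF True] show ?thesis
      unfolding instrs_of_def by blast
  next
    case False
    with that have "M \<in> {Inc, Push, Fail, Under []}" by (simp add: instrs_of_def)
    then show ?thesis by (elim insertE) (simp_all add: instrs_of_def)
  qed
  moreover have "{Inc, Push, Fail} \<subseteq> instrs_of L" by (simp add: instrs_of_def)
  ultimately show ?thesis unfolding closed_instrs_def by blast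
qed

text \<open>The word that builds a given stack.\<close>

definition cells :: "nat list \<Rightarrow> instr list" where
  "cells xs = concat (map (\<lambda>n. Push # replicate n Inc) (rev xs))"

lemma cells_simps [simp]:
  "cells [] = []" "cells (0 # xs) = cells xs @ [Push]" 
  "cells (Suc n # xs) = cells (n # xs) @ [Inc]"
  by (simp_all add: cells_def replicate_append_same)

lemma set_cells: "set (cells xs) \<subseteq> {Push, Inc}"
  by (auto simp: cells_def)

lemma closed_instrsD:
  assumes "closed_instrs Ls"
  shows "Inc \<in> Ls" "Push \<in> Ls" "Fail \<in> Ls"
    and "L \<in> Ls \<Longrightarrow> set (on_zero L) \<subseteq> Ls" "L \<in> Ls \<Longrightarrow> set (on_suc L) \<subseteq> Ls"
  using assms by (simp_all add: closed_instrs_def)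

lemma simulatesD:
  assumes "simulates Ls S e x"
  shows "e \<noteq> rzero S" "rmul S (e, e) = e" "x Fail = rzero S"
    and "L \<in> Ls \<Longrightarrow> rmul S (e, x L) = x L" "L \<in> Ls \<Longrightarrow> rmul S (x L, e) = x L"
    and "L \<in> Ls \<Longrightarrow> branching L \<Longrightarrow> rmul S (x Push, x L) = word_value S e x (on_zero L)"
    and "L \<in> Ls \<Longrightarrow> branching L \<Longrightarrow> rmul S (x Inc, x L) = word_value S e x (on_suc L)"
  using assms by (simp_all add: simulates_def)

lemma word_value_Nil [simp]: "word_value S e x [] = e"
  and word_value_snoc: "word_value S e x (w @ [L]) = rmul S (word_value S e x w, x L)"
  by (simp_all add: word_value_def)

lemma word_value_append:
  assumes S: "S \<in> Ring" and sim: "simulates Ls S e x" and u: "set u \<subseteq> Ls"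
  shows "word_value S e x (u @ v) = rmul S (word_value S e x u, word_value S e x v)"
proof (induction v rule: rev_induct)
  case Nil
  have "rmul S (word_value S e x u, e) = word_value S e x u"
    using u
  proof (induction u rule: rev_induct)
    case Nil
    then show ?case using simulatesD(2)[OF sim] by simp
  next
    case (snoc L u)
    then have "rmul S (x L, e) = x L" using simulatesD(5)[OF sim] by simp
    then show ?case by (simp add: word_value_snoc RingD(5)[OF S])
  qed
  then show ?case by simp
next
  case (snoc L v)
  then show ?case
    by (simp add: word_value_snoc RingD(5)[OF S] append_assoc[symmetric] del: append_assoc)
qed

lemma word_value_replace:
  assumes S: "S \<in> Ring" and sim: "simulates Ls S e x"
    and sub: "set u \<subseteq> Ls" "set w \<subseteq> Ls" "set w' \<subseteq> Ls"
    and eq: "word_value S e x w = word_value S e x w'"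
  shows "word_value S e x (u @ w @ v) = word_value S e x (u @ w' @ v)"
proof -
  note app = word_value_append[OF S sim]
  show ?thesis
    unfolding app[OF sub(1)] app[OF sub(2)] app[OF sub(3)] eq ..
qed

text \<open>A stack \<open>xs\<close> is itself represented by a word, so that running \<open>w\<close> on it becomes the evaluation of a product from
left to right: each step of the machine replaces \<open>Push L\<close> or \<open>Inc L\<close> inside the product by an equal word.\<close>

lemma exec_word_value:
  assumes S: "S \<in> Ring" and sim: "simulates Ls S e x" and cl: "closed_instrs Ls"
  shows "exec w xs ys \<Longrightarrow> set w \<subseteq> Ls \<Longrightarrow>
    word_value S e x (cells xs @ w) = word_value S e x (cells ys)"
proof (induction rule: exec.induct)
  case (zero L w xs ys)
  then have L: "L \<in> Ls" "set w \<subseteq> Ls" by auto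
  note Ls = closed_instrsD[OF cl] and rel = simulatesD[OF sim]
  have "word_value S e x [Push, L] = word_value S e x (on_zero L)"
    using rel(4)[OF Ls(2)] rel(6)[OF L(1) zero.hyps(1)] by (simp add: word_value_def)
  then have "word_value S e x (cells xs @ [Push, L] @ w) = word_value S e x (cells xs @ on_zero L @ w)"
    using L Ls(1,2) Ls(4)[OF L(1)] set_cells[of xs]
    by (intro word_value_replace[OF S sim]) auto
  then show ?case using zero.IH L Ls(4)[OF L(1)] by simp
next
  case (suc L w n xs ys)
  then have L: "L \<in> Ls" "set w \<subseteq> Ls" by auto
  note Ls = closed_instrsD[OF cl] and rel = simulatesD[OF sim]
  have "word_value S e x [Inc, L] = word_value S e x (on_suc L)"
    using rel(4)[OF Ls(1)] rel(7)[OF L(1) suc.hyps(1)] by (simp add: word_value_def)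
  then have "word_value S e x (cells (n # xs) @ [Inc, L] @ w) = word_value S e x (cells (n # xs) @ on_suc L @ w)"
    using L Ls(1,2) Ls(5)[OF L(1)] set_cells[of "n # xs"]
    by (intro word_value_replace[OF S sim]) auto
  then show ?case using suc.IH L Ls(5)[OF L(1)] by simp
qed auto

section \<open>A ring in which every instruction is simulated\<close>

text \<open>The action of a partial function on stacks on integer-valued functions, by composition, with \<open>0\<close> where the
partial function is undefined.  Composition in this order turns concatenation of words into the product of
operators without reversing it.\<close>

definition oper :: "instr list \<Rightarrow> (nat list \<Rightarrow> int) \<Rightarrow> nat list \<Rightarrow> int" where
  "oper w v xs = (if \<exists>ys. exec w xs ys then v (THE ys. exec w xs ys) else 0)"

lemma oper_exec: "exec w xs ys \<Longrightarrow> oper w v xs = v ys"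
  unfolding oper_def by (metis exec_deterministic the_equality)

lemma oper_append: "oper (u @ v) = oper u \<circ> oper v"
proof (intro ext, unfold comp_def)
  fix f xs
  show "oper (u @ v) f xs = oper u (oper v f) xs"
  proof (cases "\<exists>ys. exec u xs ys")
    case True
    then obtain ys where ys: "exec u xs ys" by blast
    then have iff: "exec (u @ v) xs = exec v ys"
      unfolding exec_append_iff fun_eq_iff using exec_deterministic by blast
    show ?thesis
      unfolding oper_exec[OF ys] by (simp add: oper_def iff)
  next
    case False
    then show ?thesis by (simp add: oper_def exec_append_iff)
  qed
qed

lemma oper_cong: "(\<And>xs ys. exec u xs ys \<longleftrightarrow> exec v xs ys) \<Longrightarrow> oper u = oper v"
proof -
  assume "\<And>xs ys. exec u xs ys \<longleftrightarrow> exec v xs ys"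
  then have "exec u = exec v" by (intro ext)
  then show "oper u = oper v" by (intro ext) (simp only: oper_def)
qed

text \<open>Every word of instructions, in particular the empty one, is the value of some variable.\<close>

fun interp :: "trm \<Rightarrow> (nat list \<Rightarrow> int) \<Rightarrow> nat list \<Rightarrow> int" where
  "interp (Var i) = oper (from_nat i)"
| "interp (Add s t) = (\<lambda>v xs. interp s v xs + interp t v xs)"
| "interp (Sub s t) = (\<lambda>v xs. interp s v xs - interp t v xs)"
| "interp (Mul s t) = interp s \<circ> interp t"

text \<open>The only ring law for operators that does not hold pointwise is distributivity from the left, which needs this.\<close>

lemma interp_additive: "interp s (\<lambda>xs. v xs + v' xs) = (\<lambda>xs. interp s v xs + interp s v' xs)"
proof (induction s arbitrary: v v')
  case (Mul s t)
  then show ?case by simp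
qed (auto simp: oper_def fun_eq_iff)

lemma ring_congruence_interp: "ring_congruence {(s, t). interp s = interp t}"
proof -
  have "set (ring_axioms a b c) \<subseteq> {(s, t). interp s = interp t}" for a b c
    by (simp add: ring_axioms_def Zero_def interp_additive comp_def algebra_simps)
  then show ?thesis
    unfolding ring_congruence_def by (auto split: if_splits)
qed

text \<open>The relations of \<open>simulates\<close> hold for the operators since the two sides are the same partial functions.  The
quotient is infinite because the powers of \<open>Inc\<close> act differently on the one-entry stack \<open>[0]\<close>.\<close>

theorem ring_simulating_all_instrs:
  obtains S e x where "S \<in> Ring" "simulates UNIV S e x"
proof -
  define X where "X = range (\<lambda>n. Var (to_nat (replicate n Inc)))"
  have inj: "m = n" if "oper (replicate m Inc) = oper (replicate n Inc)" for m n
  proof -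
    have ex: "exec (replicate k Inc) [i] [i + k]" for k i
      by (induction k arbitrary: i) (simp_all, metis add_Suc)
    have "oper (replicate k Inc) (\<lambda>xs. int (hd xs)) [0] = int k" for k
      using oper_exec[OF ex[of k 0]] by simp
    then show ?thesis using that by (metis of_nat_eq_iff)
  qed
  have infX: "infinite X"
    unfolding X_def by (intro range_inj_infinite) (auto simp: inj_def dest: arg_cong[of _ _ length])
  have injX: "s = t" if "s \<in> X" "t \<in> X" "(s, t) \<in> {(s, t). interp s = interp t}" for s t
    using that inj by (auto simp: X_def)
  obtain S h where S: "S \<in> Ring"
    and h: "\<And>s t. h s = h t \<longleftrightarrow> interp s = interp t"
    and mul: "\<And>s t. h (Mul s t) = rmul S (h s, h t)" and zero: "h Zero = rzero S"
    by (rule quotient_ring[OF ring_congruence_interp infX injX finite.emptyI]; (assumption | simp)?) (rule that)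
  define e where "e = h (Var (to_nat ([] :: instr list)))"
  define x where "x L = h (Var (to_nat [L]))" for L :: instr
  define t where "t w = foldl (\<lambda>s L. Mul s (Var (to_nat [L]))) (Var (to_nat ([] :: instr list))) w" for w :: "instr list"
  have t_snoc: "t (w @ [L]) = Mul (t w) (Var (to_nat [L]))" for w L
    by (simp add: t_def)
  have t: "interp (t w) = oper w \<and> h (t w) = word_value S e x w" for w
  proof (induction w rule: rev_induct)
    case (snoc L w)
    then show ?case by (simp add: t_snoc mul word_value_snoc oper_append x_def)
  qed (simp add: t_def e_def)
  have wv: "h s = word_value S e x w \<longleftrightarrow> interp s = oper w" for s w
    using t h by metis
  have "simulates UNIV S e x"
    unfolding simulates_def
  proof (intro conjI ballI impI)
    have "interp (Var (to_nat ([] :: instr list))) (\<lambda>xs. 1) [] \<noteq> interp Zero (\<lambda>xs. 1) []"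
      by (simp add: Zero_def oper_exec[of _ _ "[]"])
    then show "e \<noteq> rzero S" unfolding e_def zero[symmetric] h by metis
    have Nil: "oper [] = id"
    proof (intro ext)
      show "oper [] v xs = id v xs" for v xs using oper_exec[of "[]" xs xs] by simp
    qed
    show "rmul S (e, e) = e" unfolding e_def mul[symmetric] h by (simp add: Nil)
    show "rmul S (e, x L) = x L" "rmul S (x L, e) = x L" for L
      unfolding e_def x_def mul[symmetric] h by (simp_all add: Nil)
    show "x Fail = rzero S"
      unfolding x_def zero[symmetric] h by (auto simp: Zero_def fun_eq_iff oper_def)
    fix L assume L: "branching L"
    have "exec [Push, L] xs ys \<longleftrightarrow> exec (on_zero L) xs ys" for xs ys
      using L by (simp add: exec_branching)
    then have "oper [Push, L] = oper (on_zero L)" by (rule oper_cong)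
    then show "rmul S (x Push, x L) = word_value S e x (on_zero L)"
      unfolding x_def mul[symmetric] wv using oper_append[of "[Push]" "[L]"] by simp
    have "exec [Inc, L] xs ys \<longleftrightarrow> exec (on_suc L) xs ys" for xs ys
      using L exec_on_suc_Nil[OF L] by (cases xs) (auto simp: exec_branching)
    then have "oper [Inc, L] = oper (on_suc L)" by (rule oper_cong)
    then show "rmul S (x Inc, x L) = word_value S e x (on_suc L)"
      unfolding x_def mul[symmetric] wv using oper_append[of "[Inc]" "[L]"] by simp
  qed
  with S show thesis by (rule that)
qed

section \<open>Machine arithmetic and computable functions\<close>

text \<open>Codes are bijective, so that a search that runs through all natural numbers runs through all codes and through
nothing else.\<close>

class encodable =
  fixes encode :: "'a \<Rightarrow> nat"
  assumes bij_encode: "bij encode"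

lemma encode_eq_iff [simp]: "encode x = encode y \<longleftrightarrow> x = y"
  using bij_encode by (metis bij_is_inj injD)

lemma obtain_encode: obtains x where "n = encode x"
  using bij_encode by (metis bij_is_surj surjD)

instantiation nat :: encodable
begin
definition encode_nat_def [simp]: "encode (n :: nat) = n"
instance by standard (simp add: bij_def surj_def inj_def)
end

instantiation prod :: (encodable, encodable) encodable
begin
definition encode_prod_def: "encode p = prod_encode (encode (fst p), encode (snd p))"
instance
proof (intro_classes, rule bijI)
  show "inj (encode :: 'a \<times> 'b \<Rightarrow> nat)"
    by (rule injI) (simp add: encode_prod_def prod_eq_iff)
  have "\<exists>p :: 'a \<times> 'b. n = encode p" for n
  proof -
    obtain a b where "n = prod_encode (a, b)" by (metis prod_decode_inverse surj_pair)
    moreover obtain x y where "a = encode (x :: 'a)" "b = encode (y :: 'b)"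
      by (meson obtain_encode)
    ultimately have "n = encode (x, y)" by (simp add: encode_prod_def)
    then show ?thesis ..
  qed
  then show "surj (encode :: 'a \<times> 'b \<Rightarrow> nat)" by (simp add: surj_def)
qed
end

instantiation list :: (encodable) encodable
begin
definition encode_list_def: "encode xs = list_encode (map encode xs)"
instance
proof (intro_classes, rule bijI)
  have inj: "inj (encode :: 'a \<Rightarrow> nat)" using bij_encode by (rule bij_is_inj)
  show "inj (encode :: 'a list \<Rightarrow> nat)"
    by (rule injI) (simp add: encode_list_def list_encode_eq inj_map_eq_map[OF inj])
  have "encode (map (inv (encode :: 'a \<Rightarrow> nat)) (list_decode n)) = n" for n
    using bij_encode[where 'a = 'a]
    by (simp add: encode_list_def comp_def surj_f_inv_f[OF bij_is_surj])
  then show "surj (encode :: 'a list \<Rightarrow> nat)" by (rule surjI)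
qed
end

lemma encode_Nil: "encode [] = 0"
  and encode_Cons: "encode (y # ys) = Suc (encode (y, ys))"
  by (simp_all add: encode_list_def encode_prod_def)

text \<open>The constructors of terms are distinguished by the residue of the code modulo \<open>4\<close>.\<close>

definition tagged :: "nat \<Rightarrow> nat \<Rightarrow> nat" where "tagged k n = 4 * n + k"

lemma tagged_eq_iff: "k < 4 \<Longrightarrow> l < 4 \<Longrightarrow> tagged k m = tagged l n \<longleftrightarrow> k = l \<and> m = n"
  unfolding tagged_def by presburger

fun encode_trm_aux :: "trm \<Rightarrow> nat" where
  "encode_trm_aux (Var i) = tagged 0 i"
| "encode_trm_aux (Add s t) = tagged 1 (prod_encode (encode_trm_aux s, encode_trm_aux t))"
| "encode_trm_aux (Sub s t) = tagged 2 (prod_encode (encode_trm_aux s, encode_trm_aux t))"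
| "encode_trm_aux (Mul s t) = tagged 3 (prod_encode (encode_trm_aux s, encode_trm_aux t))"

instantiation trm :: encodable
begin
definition encode_trm_def: "encode = encode_trm_aux"
instance
proof
  have "inj encode_trm_aux"
  proof
    fix s t show "encode_trm_aux s = encode_trm_aux t \<Longrightarrow> s = t"
    proof (induction s arbitrary: t)
      case (Var i)
      then show ?case by (cases t) (simp_all add: tagged_eq_iff)
    next
      case (Add s s')
      then show ?case by (cases t) (simp_all add: tagged_eq_iff)
    next
      case (Sub s s')
      then show ?case by (cases t) (simp_all add: tagged_eq_iff)
    next
      case (Mul s s')
      then show ?case by (cases t) (simp_all add: tagged_eq_iff)
    qed
  qed
  moreover have "\<exists>t. n = encode_trm_aux t" for n
  proof (induction n rule: less_induct)
    case (less n)
    define q where "q = n div 4"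
    obtain a b where ab: "prod_encode (a, b) = q"
      by (metis prod_decode_inverse surj_pair)
    have n: "n = tagged (n mod 4) q" "n mod 4 < 4" by (simp_all add: q_def tagged_def)
    show ?case
    proof (cases "n mod 4 = 0")
      case True
      with n(1) have "n = encode_trm_aux (Var q)" by simp
      then show ?thesis ..
    next
      case False
      have "a \<le> q" "b \<le> q"
        using le_prod_encode_1[of a b] le_prod_encode_2[of b a] ab by auto
      with n(1) False have "a < n" "b < n" unfolding tagged_def by linarith+
      then obtain s t where "a = encode_trm_aux s" "b = encode_trm_aux t"
        using less by blast
      with ab have "q = prod_encode (encode_trm_aux s, encode_trm_aux t)" by simp
      moreover have "n mod 4 = 1 \<or> n mod 4 = 2 \<or> n mod 4 = 3" using False n(2) by linarith
      ultimately have "n = encode_trm_aux (Add s t) \<or> n = encode_trm_aux (Sub s t) \<or>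
          n = encode_trm_aux (Mul s t)"
        using n(1) by (elim disjE) simp_all
      then show ?thesis by blast
    qed
  qed
  ultimately show "bij (encode :: trm \<Rightarrow> nat)"
    unfolding encode_trm_def bij_def surj_def by blast
qed
end

lemma encode_trm_simps:
  "encode (Var i) = tagged 0 i"
  "encode (Add s t) = tagged 1 (encode (s, t))"
  "encode (Sub s t) = tagged 2 (encode (s, t))"
  "encode (Mul s t) = tagged 3 (encode (s, t))"
  by (simp_all add: encode_trm_def encode_prod_def)

text \<open>Words for elementary stack manipulation and for Cantor's pairing function.  Pairing uses the formula
\<open>triangle (m + n) + m\<close>; unpairing walks \<open>k\<close> steps along the diagonals, starting at \<open>(0, 0)\<close>, to reach the
\<open>k\<close>-th pair.\<close>

definition drop_word :: "instr list" where "drop_word = [Iter []]"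
definition add_word :: "instr list" where "add_word = [Iter [Inc]]"
definition dup_word :: "instr list" where
  "dup_word = [Under [Push, Push], Iter [Under [Inc], Inc]]"
definition triangle_word :: "instr list" where
  "triangle_word = [Under [Push, Push], Iter (Inc # dup_word @ [Under add_word])] @ drop_word"
definition pair_word :: "instr list" where
  "pair_word = [Under dup_word] @ add_word @ triangle_word @ add_word"
definition unpair_word :: "instr list" where
  "unpair_word = [Under [Push, Push], Iter [Branch [Inc, Under [Push]] [Under [Inc]]]]"

lemma exec_Cons: "exec [L] xs ys \<Longrightarrow> exec w ys zs \<Longrightarrow> exec (L # w) xs zs"
  using exec_append[of "[L]"] by simp

lemma exec_drop: "exec drop_word (n # xs) xs"
  using exec_Iter[of n "[]" "\<lambda>_. xs"] by (simp add: drop_word_def)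

lemma exec_add: "exec add_word (m # n # xs) ((n + m) # xs)"
  using exec_Iter[of m "[Inc]" "\<lambda>i. (n + i) # xs"] by (simp add: add_word_def)

lemma exec_dup: "exec dup_word (n # xs) (n # n # xs)"
proof -
  have "exec [Under [Push, Push]] (n # xs) (n # 0 # 0 # xs)" by (rule exec_Under) simp
  moreover have "exec [Under [Inc], Inc] (i # i # xs) (Suc i # Suc i # xs)" for i
    by (rule exec_Cons[OF exec_Under]) auto
  then have "exec [Iter [Under [Inc], Inc]] (n # 0 # 0 # xs) (n # n # xs)"
    by (rule exec_Iter[where xs = "\<lambda>i. i # i # xs"])
  ultimately show ?thesis unfolding dup_word_def by (rule exec_Cons)
qed

lemma exec_triangle: "exec triangle_word (n # xs) (triangle n # xs)"
proof -
  have "exec (Inc # dup_word @ [Under add_word]) (i # triangle i # xs) (Suc i # triangle (Suc i) # xs)" for i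
  proof -
    have "exec (dup_word @ [Under add_word]) (m # n # xs) (m # (n + m) # xs)" for m n
      by (rule exec_append[OF exec_dup exec_Under[OF exec_add]])
    from this[of "Suc i" "triangle i"] show ?thesis by simp
  qed
  then have "exec [Iter (Inc # dup_word @ [Under add_word])] (n # 0 # triangle 0 # xs) (n # triangle n # xs)"
    by (rule exec_Iter[where xs = "\<lambda>i. i # triangle i # xs"])
  moreover have "exec [Under [Push, Push]] (n # xs) (n # 0 # triangle 0 # xs)"
    by (rule exec_Under) simp
  ultimately have "exec [Under [Push, Push], Iter (Inc # dup_word @ [Under add_word])] (n # xs) (n # triangle n # xs)"
    by (rule exec_Cons[rotated])
  then show ?thesis unfolding triangle_word_def by (rule exec_append[OF _ exec_drop])
qed

lemma exec_pair: "exec pair_word (n # m # xs) (prod_encode (m, n) # xs)"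
proof -
  \<comment> \<open>The spare copy of \<open>m\<close> is added at the end.\<close>
  have "exec [Under dup_word] (n # m # xs) (n # m # m # xs)" by (rule exec_Under[OF exec_dup])
  from exec_append[OF this exec_append[OF exec_add exec_append[OF exec_triangle exec_add]]]
  show ?thesis by (simp add: pair_word_def prod_encode_def add.commute)
qed

lemma prod_decode_Suc:
  "prod_decode i = (m, 0) \<Longrightarrow> prod_decode (Suc i) = (0, Suc m)"
  "prod_decode i = (m, Suc n) \<Longrightarrow> prod_decode (Suc i) = (Suc m, n)"
proof -
  assume "prod_decode i = (m, 0)"
  then have "i = prod_encode (m, 0)" by (metis prod_decode_inverse)
  then have "Suc i = prod_encode (0, Suc m)" by (simp add: prod_encode_def)
  then show "prod_decode (Suc i) = (0, Suc m)" by simp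
next
  assume "prod_decode i = (m, Suc n)"
  then have "i = prod_encode (m, Suc n)" by (metis prod_decode_inverse)
  then have "Suc i = prod_encode (Suc m, n)" by (simp add: prod_encode_def)
  then show "prod_decode (Suc i) = (Suc m, n)" by simp
qed

lemma exec_unpair: "exec unpair_word (prod_encode (m, n) # xs) (n # m # xs)"
proof -
  define st where "st i = snd (prod_decode i) # fst (prod_decode i) # xs" for i
  define w where "w = [Branch [Inc, Under [Push]] [Under [Inc]]]"
  have "exec w (st i) (st (Suc i))" for i
  proof (cases "prod_decode i")
    case (Pair m n)
    have "exec [Inc, Under [Push]] (m # xs) (Suc m # 0 # xs)"
      using exec_Under[of "[Push]" xs "0 # xs" "Suc m"] by simp
    then have 1: "exec w (0 # m # xs) (Suc m # 0 # xs)"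
      unfolding w_def by (rule exec_Branch)
    have "exec [Under [Inc]] (k # m # xs) (k # Suc m # xs)" for k
      by (rule exec_Under) simp
    then have 2: "exec w (Suc k # m # xs) (k # Suc m # xs)" for k
      unfolding w_def by (rule exec_Branch)
    show ?thesis
      using 1 2 Pair by (cases n) (simp_all add: st_def prod_decode_Suc)
  qed
  then have "exec [Iter w] (prod_encode (m, n) # st 0) (st (prod_encode (m, n)))"
    by (rule exec_Iter)
  moreover have "prod_decode 0 = (0, 0)"
    using prod_encode_inverse[of "(0, 0)"] by (simp add: prod_encode_def)
  then have "exec [Under [Push, Push]] (prod_encode (m, n) # xs) (prod_encode (m, n) # st 0)"
    by (intro exec_Under) (simp add: st_def)
  ultimately have "exec [Under [Push, Push], Iter w] (prod_encode (m, n) # xs) (st (prod_encode (m, n)))"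
    by (rule exec_Cons[rotated])
  then show ?thesis by (simp add: unpair_word_def w_def st_def)
qed

text \<open>The rest \<open>xs\<close> of the stack is arbitrary and untouched, which is what makes words composable.\<close>

definition computes :: "instr list \<Rightarrow> ('a::encodable \<Rightarrow> 'b::encodable) \<Rightarrow> bool" where
  "computes w f \<longleftrightarrow> (\<forall>x xs. exec w (encode x # xs) (encode (f x) # xs))"

definition computable :: "('a::encodable \<Rightarrow> 'b::encodable) \<Rightarrow> bool" where
  "computable f \<longleftrightarrow> (\<exists>w. computes w f)"

lemma computableI: "(\<And>x xs. exec w (encode x # xs) (encode (f x) # xs)) \<Longrightarrow> computable f"
  unfolding computable_def computes_def by blast

lemma computableE:
  assumes "computable f"
  obtains w where "\<And>x xs. exec w (encode x # xs) (encode (f x) # xs)"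
  using assms unfolding computable_def computes_def by blast

lemma computable_encode_iff: "computable (\<lambda>x. encode (f x)) \<longleftrightarrow> computable f"
  by (simp add: computable_def computes_def)

lemma computable_id: "computable (\<lambda>x. x)"
  by (rule computableI[of "[]"]) simp

lemma computable_comp: "computable g \<Longrightarrow> computable f \<Longrightarrow> computable (\<lambda>x. g (f x))"
  by (elim computableE) (rule computableI, rule exec_append)

lemma computable_const: "computable (\<lambda>_. c)"
proof (rule computableI)
  have "exec (replicate k Inc) (i # xs) ((k + i) # xs)" for k i xs
  proof (induction k arbitrary: i)
    case (Suc k)
    from Suc[of "Suc i"] show ?case by simp
  qed simp
  from this[of "encode c" 0] have "exec (Push # replicate (encode c) Inc) xs (encode c # xs)" for xs by simp
  then show "exec (drop_word @ Push # replicate (encode c) Inc) (encode x # xs) (encode c # xs)" for x :: 'a and xs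
    by (rule exec_append[OF exec_drop])
qed

lemma exec_keep:
  assumes "\<And>x xs. exec w (encode x # xs) (encode (f x) # xs)"
  shows "exec (dup_word @ w) (encode x # xs) (encode (f x) # encode x # xs)"
  using assms by (rule exec_append[OF exec_dup])

lemma exec_pair_encode: "exec pair_word (encode y # encode x # xs) (encode (x, y) # xs)"
  by (simp add: encode_prod_def exec_pair)

lemma exec_unpair_encode: "exec unpair_word (encode (x, y) # xs) (encode y # encode x # xs)"
  by (simp add: encode_prod_def exec_unpair)

lemma computable_Pair:
  assumes "computable f" "computable g"
  shows "computable (\<lambda>x. (f x, g x))"
proof -
  obtain u where u: "\<And>x xs. exec u (encode x # xs) (encode (f x) # xs)"
    using assms(1) unfolding computable_def computes_def by blast
  obtain v where v: "\<And>x xs. exec v (encode x # xs) (encode (g x) # xs)"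
    using assms(2) unfolding computable_def computes_def by blast
  show ?thesis
  proof (rule computableI)
    fix x xs
    show "exec (dup_word @ [Under u] @ v @ pair_word) (encode x # xs) (encode (f x, g x) # xs)"
      by (rule exec_append[OF exec_dup] exec_append[OF exec_Under[OF u]] exec_append[OF v] exec_pair_encode)+
  qed
qed

lemma computable_fst:
  fixes f :: "'a::encodable \<Rightarrow> 'b::encodable \<times> 'c::encodable"
  assumes "computable f"
  shows "computable (\<lambda>x. fst (f x))"
proof -
  have "exec (unpair_word @ drop_word) (encode p # xs) (encode (fst p) # xs)" for p :: "'b \<times> 'c" and xs
    using exec_append[OF exec_unpair_encode exec_drop, of "fst p" "snd p" xs] by simp
  then have "computable (fst :: 'b \<times> 'c \<Rightarrow> _)" by (rule computableI)
  then show ?thesis using assms by (rule computable_comp)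
qed

lemma computable_snd:
  fixes f :: "'a::encodable \<Rightarrow> 'b::encodable \<times> 'c::encodable"
  assumes "computable f"
  shows "computable (\<lambda>x. snd (f x))"
proof -
  have "exec (unpair_word @ [Under drop_word]) (encode p # xs) (encode (snd p) # xs)" for p :: "'b \<times> 'c" and xs
    using exec_append[OF exec_unpair_encode exec_Under[OF exec_drop], of "fst p" "snd p" xs] by simp
  then have "computable (snd :: 'b \<times> 'c \<Rightarrow> _)" by (rule computableI)
  then show ?thesis using assms by (rule computable_comp)
qed

lemma computable_Suc: "computable f \<Longrightarrow> computable (\<lambda>x. Suc (f x))"
  by (erule computable_comp[rotated]) (rule computableI[of "[Inc]"], simp)

text \<open>The common core of case distinction on numbers and on lists: the code of a nonempty list is the successor of the
code of the pair of its head and its tail.\<close>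

lemma computable_case_encoded:
  fixes h :: "'a::encodable \<Rightarrow> 'c::encodable" and g :: "'a \<times> 'd::encodable \<Rightarrow> 'b::encodable"
  assumes "computable h" "computable f" "computable g"
    and zero: "\<And>x. encode (h x) = 0 \<Longrightarrow> k x = f x"
    and suc: "\<And>x y. encode (h x) = Suc (encode y) \<Longrightarrow> k x = g (x, y)"
  shows "computable k"
proof -
  obtain w where w: "\<And>x xs. exec w (encode x # xs) (encode (h x) # xs)"
    using assms(1) unfolding computable_def computes_def by blast
  obtain u where u: "\<And>x xs. exec u (encode x # xs) (encode (f x) # xs)"
    using assms(2) unfolding computable_def computes_def by blast
  obtain v where v: "\<And>x xs. exec v (encode x # xs) (encode (g x) # xs)"
    using assms(3) unfolding computable_def computes_def by blast
  show ?thesis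
  proof (rule computableI)
    fix x xs
    have "exec [Branch u (pair_word @ v)] (encode (h x) # encode x # xs) (encode (k x) # xs)"
    proof (cases "encode (h x)")
      case 0
      then show ?thesis using exec_Branch(1)[OF u] zero by simp
    next
      case (Suc n)
      obtain y :: 'd where "n = encode y" by (rule obtain_encode)
      with Suc show ?thesis
        using exec_Branch(2)[OF exec_append[OF exec_pair_encode v]] suc by simp
    qed
    then show "exec ((dup_word @ w) @ [Branch u (pair_word @ v)]) (encode x # xs) (encode (k x) # xs)"
      by (rule exec_append[OF exec_keep[OF w]])
  qed
qed

lemma computable_case_nat:
  assumes "computable h" "computable f" "computable (\<lambda>p. g (fst p) (snd p))"
  shows "computable (\<lambda>x. case h x of 0 \<Rightarrow> f x | Suc n \<Rightarrow> g x n)"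
  using assms by (rule computable_case_encoded) auto

lemma computable_case_list:
  assumes "computable l" "computable f" "computable (\<lambda>p. g (fst p) (fst (snd p)) (snd (snd p)))"
  shows "computable (\<lambda>x. case l x of [] \<Rightarrow> f x | y # ys \<Rightarrow> g x y ys)"
proof (rule computable_case_encoded[OF assms])
  show "(case l x of [] \<Rightarrow> f x | y # ys \<Rightarrow> g x y ys) = f x" if "encode (l x) = 0" for x
    using that by (cases "l x") (auto simp: encode_Cons)
  show "(case l x of [] \<Rightarrow> f x | y # ys \<Rightarrow> g x y ys) = g (fst (x, z)) (fst (snd (x, z))) (snd (snd (x, z)))"
    if "encode (l x) = Suc (encode z)" for x z
    using that by (cases "l x") (auto simp: encode_Cons encode_Nil)
qed

lemma computable_funpow:
  fixes f :: "'a::encodable \<Rightarrow> 'b::encodable \<Rightarrow> 'b"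
  assumes "computable (\<lambda>p. f (fst p) (snd p))" "computable h" "computable k"
  shows "computable (\<lambda>x. (f x ^^ h x) (k x))"
proof -
  have "computable (\<lambda>p. (fst p, f (fst p) (snd p)))"
    by (intro computable_Pair computable_fst computable_id assms(1))
  then obtain w where w: "\<And>p xs. exec w (encode p # xs) (encode (fst p, f (fst p) (snd p)) # xs)"
    unfolding computable_def computes_def by blast
  obtain u where u: "\<And>x xs. exec u (encode x # xs) (encode (x, k x) # xs)"
   
    using computable_Pair[OF computable_id assms(3)] unfolding computable_def computes_def by blast
  obtain v where v: "\<And>x xs. exec v (encode x # xs) (encode (h x) # xs)"
   
    using assms(2) unfolding computable_def computes_def by blast
  have "computable (\<lambda>x. (x, (f x ^^ h x) (k x)))"
  proof (rule computableI)
    fix x xs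
    have "exec w (encode (x, (f x ^^ i) (k x)) # xs) (encode (x, (f x ^^ Suc i) (k x)) # xs)" for i
      using w[of "(x, (f x ^^ i) (k x))" xs] by simp
    then have "exec [Iter w] (h x # encode (x, (f x ^^ 0) (k x)) # xs) (encode (x, (f x ^^ h x) (k x)) # xs)"
      by (rule exec_Iter[where xs = "\<lambda>i. encode (x, (f x ^^ i) (k x)) # xs"])
    then show "exec ((dup_word @ v) @ [Under u] @ [Iter w]) (encode x # xs) (encode (x, (f x ^^ h x) (k x)) # xs)"
      using exec_append[OF exec_keep[OF v] exec_append[OF exec_Under[OF u]]] by simp
  qed
  from computable_snd[OF this] show ?thesis by simp
qed

section \<open>Computability on lists and terms; unbounded search\<close>

lemma computable_Cons:
  assumes "computable f" "computable g"
  shows "computable (\<lambda>x. f x # g x)"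
proof -
  have "computable (\<lambda>x. Suc (encode (f x, g x)))"
    by (intro computable_Suc computable_encode_iff[THEN iffD2] computable_Pair assms)
  then show ?thesis
    by (simp flip: encode_Cons add: computable_encode_iff)
qed

lemma length_le_encode: "length xs \<le> encode xs"
proof (induction xs)
  case (Cons x xs)
  have "encode xs \<le> encode (x, xs)"
    by (simp add: encode_prod_def le_prod_encode_2)
  with Cons show ?case by (simp add: encode_Cons)
qed simp

text \<open>The step that consumes one list element is iterated as often as the code of the list says.  This is at least the
length of the list, and further steps do nothing once the list is empty.\<close>

lemma computable_foldl:
  fixes f :: "'a::encodable \<Rightarrow> 'b::encodable \<Rightarrow> 'c::encodable \<Rightarrow> 'b"
  assumes f: "computable (\<lambda>p. f (fst p) (fst (snd p)) (snd (snd p)))" and a: "computable a" and l: "computable l"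
  shows "computable (\<lambda>x. foldl (f x) (a x) (l x))"
proof -
  define step where "step x s = (case snd s of [] \<Rightarrow> s | y # ys \<Rightarrow> (f x (fst s) y, ys))" for x s
  have "(step x ^^ n) (b, ys) = (foldl (f x) b (take n ys), drop n ys)" for x n b ys
  proof (induction n arbitrary: b ys)
    case (Suc n)
    then show ?case
      by (cases ys) (simp_all add: step_def funpow_Suc_right del: funpow.simps)
  qed simp
  from this[of "encode (l _)" _ _ "l _"]
  have eq: "foldl (f x) (a x) (l x) = fst ((step x ^^ encode (l x)) (a x, l x))" for x
    by (simp add: length_le_encode)
  have "computable (\<lambda>q :: ('a \<times> 'b \<times> 'c list) \<times> 'c \<times> 'c list. f (fst (fst q)) (fst (snd (fst q))) (fst (snd q)))"
    using computable_comp[OF f, of "\<lambda>q. (fst (fst q), fst (snd (fst q)), fst (snd q))"]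
    by (simp add: computable_Pair computable_fst computable_snd computable_id)
  then have "computable (\<lambda>p. step (fst p) (snd p))"
    unfolding step_def
    by (intro computable_case_list computable_Pair computable_fst computable_snd computable_id)
  then show ?thesis
    unfolding eq
    by (intro computable_fst computable_funpow computable_Pair computable_encode_iff[THEN iffD2] a l)
qed

lemma computable_append:
  assumes "computable f" "computable g"
  shows "computable (\<lambda>x. f x @ g x)"
proof -
  have push: "foldl (\<lambda>acc y. y # acc) acc ys = rev ys @ acc" for acc ys :: "'b list"
    by (induction ys arbitrary: acc) auto
  have "f x @ g x = foldl (\<lambda>acc y. y # acc) (g x) (foldl (\<lambda>acc y. y # acc) [] (f x))" for x
    by (simp add: push)
  then show ?thesis
    by (simp only:) (intro computable_foldl computable_Cons computable_const computable_fst computable_snd computable_id assms)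
qed

text \<open>Truth values are computed as the numbers \<open>0\<close> and \<open>1\<close>, which \<open>Branch\<close> and \<open>While\<close> can test.\<close>

definition decidable :: "('a::encodable \<Rightarrow> bool) \<Rightarrow> bool" where
  "decidable P \<longleftrightarrow> computable (\<lambda>x. of_bool (P x) :: nat)"

lemma computable_if:
  assumes "decidable P" "computable f" "computable g"
  shows "computable (\<lambda>x. if P x then f x else g x)"
proof -
  have "(if P x then f x else g x) = (case of_bool (P x) of 0 \<Rightarrow> g x | Suc n \<Rightarrow> f x)" for x
    by simp
  then show ?thesis
    using assms unfolding decidable_def
    by (simp only:) (intro computable_case_nat computable_comp[OF assms(2)] computable_fst computable_id)
qed

lemma decidable_conj:
  assumes "decidable P" "decidable Q"
  shows "decidable (\<lambda>x. P x \<and> Q x)"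
proof -
  have "of_bool (P x \<and> Q x) = (if P x then of_bool (Q x) else 0 :: nat)" for x by simp
  then show ?thesis
    unfolding decidable_def
    by (simp only:) (intro computable_if computable_const assms(2)[unfolded decidable_def] assms(1))
qed

lemma decidable_not:
  assumes "decidable P"
  shows "decidable (\<lambda>x. \<not> P x)"
proof -
  have "of_bool (\<not> P x) = (if P x then 0 else 1 :: nat)" for x by simp
  then show ?thesis
    unfolding decidable_def by (simp only:) (intro computable_if computable_const assms)
qed

lemma decidable_disj: "decidable P \<Longrightarrow> decidable Q \<Longrightarrow> decidable (\<lambda>x. P x \<or> Q x)"
  using decidable_not[OF decidable_conj[OF decidable_not decidable_not]] by simp

text \<open>Truncated subtraction is iterated predecessor.\<close>

lemma decidable_less:
  assumes "computable f" "computable g"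
  shows "decidable (\<lambda>x. g x < (f x :: nat))"
proof -
  have "((\<lambda>k. case k of 0 \<Rightarrow> 0 | Suc k \<Rightarrow> k) ^^ n) m = m - n" for m n :: nat
    by (induction n) (auto split: nat.split)
  then have "of_bool (g x < f x) = (case ((\<lambda>k. case k of 0 \<Rightarrow> 0 | Suc k \<Rightarrow> k) ^^ g x) (f x) of 0 \<Rightarrow> 0 | Suc _ \<Rightarrow> (1 :: nat))" for x
    by (simp split: nat.split)
  then show ?thesis
    unfolding decidable_def
    by (simp only:) (intro computable_case_nat computable_funpow computable_const computable_fst computable_snd computable_id assms)
qed

lemma decidable_eq:
  assumes "computable f" "computable g"
  shows "decidable (\<lambda>x. f x = g x)"
proof -
  have "f x = g x \<longleftrightarrow> \<not> encode (f x) < encode (g x) \<and> \<not> encode (g x) < encode (f x)" for x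
    by (metis encode_eq_iff nat_neq_iff)
  then show ?thesis
    by (simp only:) (intro decidable_conj decidable_not decidable_less computable_encode_iff[THEN iffD2] assms)
qed

lemma decidable_member:
  assumes "computable f" "computable g"
  shows "decidable (\<lambda>x. f x \<in> set (g x))"
proof -
  have "foldl (\<lambda>b z. if z = y then 1 else b) b ys = (if y \<in> set ys then 1 else b)" for y :: 'b and b :: nat and ys
    by (induction ys arbitrary: b) auto
  then have "of_bool (f x \<in> set (g x)) = foldl (\<lambda>b z. if z = f x then 1 else b) (0 :: nat) (g x)" for x
    by simp
  then show ?thesis
    unfolding decidable_def
    by (simp only:) (intro computable_foldl computable_if decidable_eq computable_comp[OF assms(1)] computable_const
        computable_fst computable_snd computable_id assms)
qed

lemma computable_tagged:
  assumes "computable f"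
  shows "computable (\<lambda>x. tagged k (f x))"
proof -
  have "((\<lambda>m. Suc (Suc (Suc (Suc m)))) ^^ n) k = tagged k n" for n
    by (induction n) (simp_all add: tagged_def)
  then have "tagged k (f x) = ((\<lambda>m. Suc (Suc (Suc (Suc m)))) ^^ f x) k" for x by simp
  then show ?thesis
    by (simp only:) (intro computable_funpow computable_Suc computable_const computable_snd computable_id assms)
qed

lemma computable_Var: "computable f \<Longrightarrow> computable (\<lambda>x. Var (f x))"
  and computable_Add: "computable s \<Longrightarrow> computable t \<Longrightarrow> computable (\<lambda>x. Add (s x) (t x))"
  and computable_Sub: "computable s \<Longrightarrow> computable t \<Longrightarrow> computable (\<lambda>x. Sub (s x) (t x))"
  and computable_Mul: "computable s \<Longrightarrow> computable t \<Longrightarrow> computable (\<lambda>x. Mul (s x) (t x))"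
  by (subst computable_encode_iff[symmetric], unfold encode_trm_simps,
      intro computable_tagged computable_encode_iff[THEN iffD2] computable_Pair; assumption)+

lemmas computable_intros =
  computable_if decidable_conj decidable_disj decidable_not decidable_eq decidable_member
  computable_Var computable_Add computable_Sub computable_Mul
  computable_append computable_Cons computable_Pair computable_fst computable_snd computable_id computable_const

text \<open>Unbounded search.  The witness found does not depend on the rest of the stack, hence the order of the quantifiers.\<close>

lemma search:
  fixes P :: "'a::encodable \<times> 'b::encodable \<Rightarrow> bool" and h :: "'a \<times> 'b \<Rightarrow> 'c::encodable"
  assumes P: "decidable P" and h: "computable h"
  obtains w where "\<And>x. \<exists>d. P (x, d) \<Longrightarrow>
    \<exists>d. P (x, d) \<and> (\<forall>xs. exec w (encode x # xs) (encode (h (x, d)) # xs))"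
proof -
  define dec :: "nat \<Rightarrow> 'b" where "dec = inv encode"
  have dec: "encode (dec n) = n" for n
    unfolding dec_def using bij_is_surj[OF bij_encode] by (rule surj_f_inv_f)
  have dec': "encode (x, dec n) = encode (x, n)" for x :: 'a and n
    by (simp add: encode_prod_def dec)
  obtain wf where wf: "\<And>p xs. exec wf (encode p # xs) (of_bool (\<not> P p) # xs)"
    using decidable_not[OF P] unfolding decidable_def computable_def computes_def by auto
  obtain wh where wh: "\<And>p xs. exec wh (encode p # xs) (encode (h p) # xs)"
    using h unfolding computable_def computes_def by blast
  have "computable (\<lambda>x :: 'a. (x, 0 :: nat))" "computable (\<lambda>p :: 'a \<times> nat. (fst p, Suc (snd p)))"
    by (intro computable_intros computable_Suc)+
  then obtain w0 wn where w0: "\<And>(x :: 'a) xs. exec w0 (encode x # xs) (encode (x, 0 :: nat) # xs)"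
    and wn: "\<And>(p :: 'a \<times> nat) xs. exec wn (encode p # xs) (encode (fst p, Suc (snd p)) # xs)"
    unfolding computable_def computes_def by blast
  \<comment> \<open>The flag above the current candidate tells whether the search has to go on.\<close>
  define flag where "flag = dup_word @ wf"
  have flag: "exec flag (encode (x, n) # xs) (of_bool (\<not> P (x, dec n)) # encode (x, n) # xs)" for x n xs
    unfolding flag_def using exec_append[OF exec_dup wf[of "(x, dec n)"]] by (simp add: dec')
  define loop where "loop = [While (drop_word @ wn @ flag)]"
  have loop: "exec loop (of_bool (\<not> P (x, dec n)) # encode (x, n) # xs) (0 # encode (x, n + k) # xs)"
    if "P (x, dec (n + k))" "\<And>j. j < k \<Longrightarrow> \<not> P (x, dec (n + j))" for x n k xs
    using that
  proof (induction k arbitrary: n)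
    case 0
    then show ?case unfolding loop_def using exec_While(1) by simp
  next
    case (Suc k)
    have "exec (drop_word @ wn @ flag) (Suc 0 # encode (x, n) # xs)
        (of_bool (\<not> P (x, dec (Suc n))) # encode (x, Suc n) # xs)"
      using exec_append[OF exec_drop exec_append[OF wn[of "(x, n)", unfolded fst_conv snd_conv] flag[of x "Suc n"]]]
      by simp
    moreover have "exec loop (of_bool (\<not> P (x, dec (Suc n))) # encode (x, Suc n) # xs) (0 # encode (x, Suc n + k) # xs)"
      using Suc.prems(1) Suc.prems(2)[of "Suc _"] by (intro Suc.IH) auto
    ultimately have "exec loop (Suc 0 # encode (x, n) # xs) (0 # encode (x, Suc n + k) # xs)"
      unfolding loop_def by (rule exec_While(2))
    then show ?case using Suc.prems(2)[of 0] by simp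
  qed
  show thesis
  proof
    fix x assume "\<exists>d. P (x, d)"
    then obtain d where "P (x, d)" ..
    moreover have "dec (encode d) = d"
      unfolding dec_def using bij_is_inj[OF bij_encode] by (rule inv_f_f)
    ultimately have ex: "P (x, dec (encode d))" by simp
    define k where "k = (LEAST n. P (x, dec n))"
    have Pk: "P (x, dec k)" unfolding k_def using ex by (rule LeastI)
    have "exec loop (of_bool (\<not> P (x, dec 0)) # encode (x, 0 :: nat) # xs) (0 # encode (x, 0 + k) # xs)" for xs
    proof (rule loop)
      show "P (x, dec (0 + k))" using Pk by simp
      show "\<not> P (x, dec (0 + j))" if "j < k" for j
        using not_less_Least[OF that[unfolded k_def]] by simp
    qed
    then have k: "exec loop (of_bool (\<not> P (x, dec 0)) # encode (x, 0 :: nat) # xs) (0 # encode (x, k) # xs)" for xs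
      by simp
    have "exec (w0 @ flag @ loop @ drop_word @ wh) (encode x # xs) (encode (h (x, dec k)) # xs)" for xs
      using exec_append[OF w0 exec_append[OF flag exec_append[OF k exec_append[OF exec_drop wh[of "(x, dec k)", unfolded dec']]]]] .
    with Pk show "\<exists>d. P (x, d) \<and> (\<forall>xs. exec (w0 @ flag @ loop @ drop_word @ wh) (encode x # xs) (encode (h (x, d)) # xs))"
      by blast
  qed
qed

section \<open>A diagonal program that searches for derivations\<close>

type_synonym inference = "(trm \<times> trm \<times> trm) \<times> (trm \<times> trm) \<times> (trm \<times> trm)"

text \<open>An inference lists the instances for the ring axioms and names two earlier equations.  All axiom instances
and all conclusions are added at once, so that an inference carries no choice of a rule; equations that
have not been derived before contribute nothing.\<close>

fun extend_derivation :: "(trm \<times> trm) list \<Rightarrow> inference \<Rightarrow> (trm \<times> trm) list" where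
  "extend_derivation L ((a, b, c), d, d') =
    (if d \<in> set L \<and> d' \<in> set L then consequences d d' else []) @ ring_axioms a b c @ L"

lemma foldl_extend_derivation_sound:
  "set L \<subseteq> Th E \<Longrightarrow> set (foldl extend_derivation L ds) \<subseteq> Th E"
proof (induction ds arbitrary: L)
  case (Cons i ds)
  obtain a b c d d' where i: "i = ((a, b, c), d, d')" by (metis surj_pair)
  have "set (extend_derivation L i) \<subseteq> Th E"
    using Cons.prems unfolding i by (auto intro: Th.infer Th.ax)
  then show ?case using Cons.IH by simp
qed simp

lemma foldl_extend_derivation_mono: "set L \<subseteq> set (foldl extend_derivation L ds)"
proof (induction ds arbitrary: L)
  case (Cons i ds)
  obtain a b c d d' where i: "i = ((a, b, c), d, d')" by (metis surj_pair)
  have "set L \<subseteq> set (extend_derivation L i)" unfolding i by auto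
  then show ?case using Cons.IH[of "extend_derivation L i"] by simp
qed simp

text \<open>The list of equations from which the derivation starts is generalized, because a derivation of the second premise
continues one of the first.\<close>

lemma foldl_extend_derivation_complete:
  "e \<in> Th E \<Longrightarrow> E \<subseteq> set L \<Longrightarrow> \<exists>ds. e \<in> set (foldl extend_derivation L ds)"
proof (induction arbitrary: L rule: Th.induct)
  case (hyp d)
  then have "d \<in> set (foldl extend_derivation L [])" by auto
  then show ?case by blast
next
  case (ax d a b c)
  then have "d \<in> set (foldl extend_derivation L [((a, b, c), d, d)])" by simp
  then show ?case by blast
next
  case (infer d d' d'')
  obtain ds where ds: "d \<in> set (foldl extend_derivation L ds)" using infer by blast
  let ?L = "foldl extend_derivation L ds"
  have "E \<subseteq> set ?L" using infer.prems foldl_extend_derivation_mono by blast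
  then obtain ds' where ds': "d' \<in> set (foldl extend_derivation ?L ds')" using infer by blast
  let ?L' = "foldl extend_derivation ?L ds'"
  have "d \<in> set ?L'" using ds foldl_extend_derivation_mono by blast
  then have "d'' \<in> set (extend_derivation ?L' ((Zero, Zero, Zero), d, d'))"
    using ds' infer.hyps by simp
  then have "d'' \<in> set (foldl extend_derivation L (ds @ ds' @ [((Zero, Zero, Zero), d, d')]))"
    by simp
  then show ?case by blast
qed

lemma consequences_eq:
  "consequences d d' =
    [(snd d, fst d), (if snd d = fst d' then (fst d, snd d') else d),
     (Add (fst d) (fst d'), Add (snd d) (snd d')), (Sub (fst d) (fst d'), Sub (snd d) (snd d')),
     (Mul (fst d) (fst d'), Mul (snd d) (snd d'))]"
  by (cases d, cases d') simp

lemma extend_derivation_eq: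
  "extend_derivation L i =
    (if fst (snd i) \<in> set L \<and> snd (snd i) \<in> set L then consequences (fst (snd i)) (snd (snd i)) else []) @
    ring_axioms (fst (fst i)) (fst (snd (fst i))) (snd (snd (fst i))) @ L"
  by (cases "(L, i)" rule: extend_derivation.cases) simp

lemma computable_derivation:
  assumes "computable L" "computable ds"
  shows "computable (\<lambda>x. foldl extend_derivation (L x) (ds x))"
proof (rule computable_foldl[OF _ assms])
  show "computable (\<lambda>p :: 'a \<times> (trm \<times> trm) list \<times> inference. extend_derivation (fst (snd p)) (snd (snd p)))"
    unfolding extend_derivation_eq consequences_eq ring_axioms_def
    by (intro computable_intros)
qed

type_synonym presentation = "(trm \<times> trm) list \<times> nat \<times> nat \<times> nat"

text \<open>A product that represents the run of an instruction \<open>c\<close> on input \<open>n\<close>, with \<open>p\<close> and \<open>i\<close> denoting \<open>Push\<close> and \<open>Inc\<close>.  The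
second \<open>Push\<close> starts the instruction by its clause for zero.\<close>

definition pulse :: "nat \<Rightarrow> nat \<Rightarrow> nat \<Rightarrow> nat \<Rightarrow> trm" where
  "pulse n p i c = Mul (Mul (((\<lambda>s. Mul s (Var i)) ^^ n) (Var p)) (Var p)) (Var c)"

text \<open>The diagonal step: the input is the code of the presentation together with the names of the very elements that
occur in the product.\<close>

definition probe :: "presentation \<Rightarrow> trm" where
  "probe x = pulse (encode x) (fst (snd x)) (fst (snd (snd x))) (snd (snd (snd x)))"

type_synonym witness = "nat \<times> nat \<times> inference list"

text \<open>A witness for the probe being zero in all rings that satisfy the list of equations.\<close>

definition forces_zero :: "presentation \<times> witness \<Rightarrow> bool" where
  "forces_zero = (\<lambda>(x, i, j, ds). (probe x, Zero) \<in> set (foldl extend_derivation (fst x) ds))"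

text \<open>A witness for the probe being nonzero in all these rings: setting it to zero identifies two numbers.\<close>

definition forces_nonzero :: "presentation \<times> witness \<Rightarrow> bool" where
  "forces_nonzero = (\<lambda>(x, i, j, ds). i \<noteq> j \<and>
     (Var i, Var j) \<in> set (foldl extend_derivation ((probe x, Zero) # fst x) ds))"

lemma computable_probe: "computable f \<Longrightarrow> computable (\<lambda>x. probe (f x))"
proof -
  have "computable (\<lambda>x. probe x)"
    unfolding probe_def pulse_def
    by (intro computable_intros computable_funpow computable_encode_iff[THEN iffD2])
  then show "computable f \<Longrightarrow> computable (\<lambda>x. probe (f x))" by (rule computable_comp)
qed

lemma decidable_forces: "decidable forces_zero" "decidable forces_nonzero"
proof -
  show "decidable forces_zero"
    unfolding forces_zero_def case_prod_beta
    by (intro computable_intros computable_derivation computable_probe)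
  show "decidable forces_nonzero"
    unfolding forces_nonzero_def case_prod_beta
    by (intro computable_intros computable_derivation computable_probe)
qed

lemma ex_forces_zero: "(\<exists>d. forces_zero (x, d)) \<longleftrightarrow> (probe x, Zero) \<in> Th (set (fst x))"
proof
  assume "\<exists>d. forces_zero (x, d)"
  then show "(probe x, Zero) \<in> Th (set (fst x))"
    using foldl_extend_derivation_sound[of "fst x" "set (fst x)"]
    by (force simp: forces_zero_def intro: Th.hyp)
next
  assume "(probe x, Zero) \<in> Th (set (fst x))"
  from foldl_extend_derivation_complete[OF this subset_refl]
  show "\<exists>d. forces_zero (x, d)" by (auto simp: forces_zero_def)
qed

lemma ex_forces_nonzero: "(\<exists>d. forces_nonzero (x, d)) \<longleftrightarrow>
    (\<exists>i j. i \<noteq> j \<and> (Var i, Var j) \<in> Th (insert (probe x, Zero) (set (fst x))))"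
proof
  assume "\<exists>d. forces_nonzero (x, d)"
  then obtain i j ds where d: "i \<noteq> j"
    "(Var i, Var j) \<in> set (foldl extend_derivation ((probe x, Zero) # fst x) ds)"
    by (auto simp: forces_nonzero_def)
  have "set ((probe x, Zero) # fst x) \<subseteq> Th (insert (probe x, Zero) (set (fst x)))"
    by (auto intro: Th.hyp)
  from foldl_extend_derivation_sound[OF this] d
  show "\<exists>i j. i \<noteq> j \<and> (Var i, Var j) \<in> Th (insert (probe x, Zero) (set (fst x)))" by blast
next
  assume "\<exists>i j. i \<noteq> j \<and> (Var i, Var j) \<in> Th (insert (probe x, Zero) (set (fst x)))"
  then obtain i j where ij: "i \<noteq> j" "(Var i, Var j) \<in> Th (insert (probe x, Zero) (set (fst x)))" by blast
  have "insert (probe x, Zero) (set (fst x)) \<subseteq> set ((probe x, Zero) # fst x)" by simp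
  from foldl_extend_derivation_complete[OF ij(2) this] ij(1)
  show "\<exists>d. forces_nonzero (x, d)" by (auto simp: forces_nonzero_def)
qed

lemma eval_pulse:
  assumes sim: "simulates Ls S e y" and cl: "closed_instrs Ls"
  shows "eval S (pulse n (y Push) (y Inc) (y L)) = word_value S e y (cells [n] @ [Push, L])"
proof -
  have "rmul S (e, y Push) = y Push"
    using simulatesD(4)[OF sim] closed_instrsD(2)[OF cl] by simp
  then have "eval S (((\<lambda>s. Mul s (Var (y Inc))) ^^ n) (Var (y Push))) = word_value S e y (cells [n])"
    by (induction n) (simp_all add: word_value_snoc, simp add: word_value_def)
  then show ?thesis
    by (simp add: pulse_def word_value_def)
qed

definition models :: "ring_struct \<Rightarrow> (trm \<times> trm) set \<Rightarrow> bool" where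
  "models S E \<longleftrightarrow> (\<forall>(s, t)\<in>E. eval S s = eval S t)"

lemma models_Th: "S \<in> Ring \<Longrightarrow> models S E \<Longrightarrow> (s, t) \<in> Th E \<Longrightarrow> eval S s = eval S t"
  unfolding models_def by (rule Th_sound)

text \<open>The program searches for a witness of one of the two kinds.  If the first witness found forces the probe to be zero,
the run succeeds and makes the probe equal to \<open>e\<close>, which is not zero; otherwise the run ends in \<open>Fail\<close> and makes
the probe zero, although it is forced not to be.  Both contradict soundness in the ring \<open>S\<close>, so there
is no witness of either kind.  As only the first witness matters, it is harmless that there may be witnesses of
both kinds for lists \<open>E\<close> without a model.\<close>

theorem rosser_instr:
  obtains L where "\<And>S e y E x. S \<in> Ring \<Longrightarrow> simulates (instrs_of L) S e y \<Longrightarrow> models S (set E) \<Longrightarrow>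
    x = (E, y Push, y Inc, y L) \<Longrightarrow>
    (probe x, Zero) \<notin> Th (set E) \<and>
    (\<forall>i j. (Var i, Var j) \<in> Th (insert (probe x, Zero) (set E)) \<longrightarrow> i = j)"
proof -
  have "decidable (\<lambda>p. forces_zero p \<or> forces_nonzero p)"
    by (intro decidable_disj decidable_forces)
  then obtain w where w: "\<And>x. \<exists>d. forces_zero (x, d) \<or> forces_nonzero (x, d) \<Longrightarrow>
      \<exists>d. (forces_zero (x, d) \<or> forces_nonzero (x, d)) \<and>
        (\<forall>xs. exec w (encode x # xs) (encode (of_bool (forces_zero (x, d)) :: nat) # xs))"
    by (rule search[OF _ decidable_forces(1)[unfolded decidable_def]]) (rule that)
  \<comment> \<open>\<open>B\<close> turns the answer of the search into the word \<open>Fail\<close>, or removes it and leaves the empty stack, whose value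
    is \<open>e\<close>.\<close>
  define B where "B = Branch [Fail] drop_word"
  define L where "L = Branch (w @ [B]) []"
  show thesis
  proof (rule that[of L], rule ccontr)
    fix S e y E x
    assume S: "S \<in> Ring" and sim: "simulates (instrs_of L) S e y" and E: "models S (set E)"
      and x: "x = (E, y Push, y Inc, y L)"
      and "\<not> ((probe x, Zero) \<notin> Th (set E) \<and>
        (\<forall>i j. (Var i, Var j) \<in> Th (insert (probe x, Zero) (set E)) \<longrightarrow> i = j))"
    then have "\<exists>d. forces_zero (x, d) \<or> forces_nonzero (x, d)"
      unfolding ex_disj_distrib ex_forces_zero ex_forces_nonzero by auto
    from w[OF this] obtain d where d: "forces_zero (x, d) \<or> forces_nonzero (x, d)"
      and ex: "exec w [encode x] [encode (of_bool (forces_zero (x, d)) :: nat)]" by blast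
    from ex have ex: "exec w [encode x] [of_bool (forces_zero (x, d))]" by simp
    note cl = closed_instrs_of[of L] and rel = simulatesD[OF sim]
    note val = exec_word_value[OF S sim cl] and app = word_value_append[OF S sim]
    have "L \<in> sub_instrs L" by (rule self_sub_instrs)
    then have L: "L \<in> instrs_of L" by (simp add: instrs_of_def)
    then have "set (on_zero L) \<subseteq> instrs_of L" by (rule closed_instrsD(4)[OF cl])
    then have wB: "set w \<subseteq> instrs_of L" "B \<in> instrs_of L" by (auto simp: L_def)
    have cells: "set (cells xs) \<subseteq> instrs_of L" for xs
      using set_cells[of xs] closed_instrsD(1,2)[OF cl] by auto
    have on_zero_value: "word_value S e y [Push, K] = word_value S e y (on_zero K)"
      if "K \<in> instrs_of L" "branching K" for K
      using rel(4)[OF closed_instrsD(2)[OF cl]] rel(6)[OF that] by (simp add: word_value_def)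
    have "eval S (probe x) = word_value S e y (cells [encode x] @ [Push, L])"
      unfolding probe_def x by (simp add: eval_pulse[OF sim cl])
    also have "\<dots> = word_value S e y (cells [encode x] @ w @ [B])"
      using on_zero_value[OF L] by (simp only: app[OF cells]) (simp add: L_def)
    also have "\<dots> = rmul S (word_value S e y (cells [encode x] @ w), word_value S e y [B])"
      using wB cells app[of "cells [encode x] @ w" "[B]"] by simp
    also have "\<dots> = word_value S e y (cells [of_bool (forces_zero (x, d))] @ [B])"
      by (simp only: val[OF ex wB(1)] app[OF cells, where v = "[B]"])
    finally have probe: "eval S (probe x) = word_value S e y (cells [of_bool (forces_zero (x, d))] @ [B])" .
    show False
    proof (cases "forces_zero (x, d)")
      case True
      have "exec [B] [1] []"
        unfolding B_def using exec_Branch(2)[OF exec_drop[of 0 "[]"]] by simp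
      from val[OF this] wB(2) True probe have "eval S (probe x) = e" by simp
      moreover have "eval S (probe x) = eval S Zero"
      proof (rule models_Th[OF S E])
        have "\<exists>d. forces_zero (x, d)" using True ..
        then show "(probe x, Zero) \<in> Th (set E)" unfolding ex_forces_zero by (simp add: x)
      qed
      ultimately show False using rel(1) by (simp add: eval_Zero[OF S])
    next
      case False
      have "eval S (probe x) = word_value S e y [Push, B]"
        using probe False by simp
      also have "\<dots> = rmul S (e, y Fail)"
        using on_zero_value[OF wB(2)] by (simp add: B_def word_value_def)
      also have "\<dots> = eval S Zero"
        using rel(3) rel(4)[OF closed_instrsD(3)[OF cl]] by (simp add: eval_Zero[OF S])
      finally have "models S (insert (probe x, Zero) (set E))"
        using E by (simp add: models_def)
      from models_Th[OF S this] have "\<not> (\<exists>d. forces_nonzero (x, d))"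
        unfolding ex_forces_nonzero x by force
      with d False show False by blast
    qed
  qed
qed

text \<open>All names denote different elements of the quotient, which is therefore infinite; the names that occur in \<open>T\<close> keep
their meaning in a suitable enumeration.\<close>

lemma ring_realizing_congruence:
  assumes r: "ring_congruence r" "\<And>i j. (Var i, Var j) \<in> r \<Longrightarrow> i = j" and T: "finite T"
  obtains S where "S \<in> Ring" "\<And>s t. s \<in> T \<Longrightarrow> t \<in> T \<Longrightarrow> eval S s = eval S t \<longleftrightarrow> (s, t) \<in> r"
proof -
  define F where "F = \<Union> (vars ` T)"
  have inf: "infinite (range Var)" by (rule range_inj_infinite) (simp add: inj_def)
  have inj: "s = t" if "s \<in> range Var" "t \<in> range Var" "(s, t) \<in> r" for s t
    using that r(2) by auto
  have fin: "finite F" using T finite_vars by (simp add: F_def)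
  obtain S h where S: "S \<in> Ring" and h: "\<And>s t. h s = h t \<longleftrightarrow> (s, t) \<in> r"
    and hom: "\<And>s t. h (Add s t) = radd S (h s, h t)" "\<And>s t. h (Sub s t) = rsub S (h s, h t)"
      "\<And>s t. h (Mul s t) = rmul S (h s, h t)"
    and fixes_F: "\<And>i. i \<in> F \<Longrightarrow> h (Var i) = i"
    by (rule quotient_ring[OF r(1) inf inj fin r(2)]) (assumption+, rule that)
  have "vars t \<subseteq> F \<Longrightarrow> eval S t = h t" for t
    by (induction t) (simp_all add: hom fixes_F)
  then have "eval S t = h t" if "t \<in> T" for t
    using that by (auto simp: F_def)
  with S h show thesis by (intro that) auto
qed

text \<open>The first ring is the quotient by all consequences of \<open>E\<close> and \<open>t = 0\<close>.  For the second one the provable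
equations are intersected with those that hold in \<open>S\<close>, which amounts to a subring of a product with
\<open>S\<close>; the second factor keeps different names different.\<close>

lemma undecided_probe:
  assumes S: "S \<in> Ring" "models S (set E)"
    and indep: "(t, Zero) \<notin> Th (set E)" "\<And>i j. (Var i, Var j) \<in> Th (insert (t, Zero) (set E)) \<Longrightarrow> i = j"
  obtains S1 S2 where "S1 \<in> Ring" "models S1 (set E)" "eval S1 t = rzero S1"
    "S2 \<in> Ring" "models S2 (set E)" "eval S2 t \<noteq> rzero S2"
proof -
  define T where "T = insert t (insert Zero (fst ` set E \<union> snd ` set E))"
  have T: "finite T" "t \<in> T" "Zero \<in> T" by (simp_all add: T_def)
  have TE: "s \<in> T \<and> u \<in> T" if "(s, u) \<in> set E" for s u
    using that by (force simp: T_def)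
  obtain S1 where S1: "S1 \<in> Ring"
    "\<And>s u. s \<in> T \<Longrightarrow> u \<in> T \<Longrightarrow> eval S1 s = eval S1 u \<longleftrightarrow> (s, u) \<in> Th (insert (t, Zero) (set E))"
    by (rule ring_realizing_congruence[OF ring_congruence_Th indep(2) T(1)]) (assumption, rule that)
  have S1E: "models S1 (set E)"
    using S1(2) TE by (auto simp: models_def intro: Th.hyp)
  have S1t: "eval S1 t = rzero S1"
    using S1(2)[OF T(2,3)] eval_Zero[OF S1(1)] by (simp add: Th.hyp)
  define r where "r = Th (set E) \<inter> {(s, u). eval S s = eval S u}"
  have rr: "ring_congruence r"
    unfolding r_def by (intro ring_congruence_Int ring_congruence_Th ring_congruence_eval S(1))
  have r_inj: "i = j" if "(Var i, Var j) \<in> r" for i j using that by (simp add: r_def)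
  obtain S2 where S2: "S2 \<in> Ring"
    "\<And>s u. s \<in> T \<Longrightarrow> u \<in> T \<Longrightarrow> eval S2 s = eval S2 u \<longleftrightarrow> (s, u) \<in> r"
    by (rule ring_realizing_congruence[OF rr r_inj T(1)]) (assumption, rule that)
  have "models S2 (set E)"
    using S2(2) TE S(2) by (auto simp: models_def r_def intro: Th.hyp)
  moreover have "eval S2 t \<noteq> rzero S2"
    using S2(2)[OF T(2,3)] indep(1) eval_Zero[OF S2(1)] by (auto simp: r_def)
  ultimately show thesis using S1(1) S1E S1t S2(1) that by blast
qed

section \<open>Topology of the space of rings and the category argument\<close>

text \<open>Evaluating a table at arguments that vary with the ring is continuous, since the arguments are locally constant.\<close>

lemma continuous_on_nat_op:
  fixes f g :: "'a::topological_space \<Rightarrow> nat" and c :: "'a \<Rightarrow> nat \<times> nat \<Rightarrow> nat"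
  assumes "continuous_on UNIV f" "continuous_on UNIV g" "\<And>p. continuous_on UNIV (\<lambda>S. c S p)"
  shows "continuous_on UNIV (\<lambda>S. c S (f S, g S))"
proof -
  have "open ((\<lambda>S. c S (f S, g S)) -` B)" for B
  proof -
    have eq: "(\<lambda>S. c S (f S, g S)) -` B = (\<Union>a b. f -` {a} \<inter> g -` {b} \<inter> (\<lambda>S. c S (a, b)) -` B)"
      by auto
    show ?thesis
      unfolding eq by (intro open_UN open_Int ballI open_vimage assms open_discrete)
  qed
  then show ?thesis by (simp add: continuous_on_open_vimage)
qed

lemma continuous_on_rzero: "continuous_on UNIV rzero"
  by (intro continuous_on_snd continuous_on_id)

lemma continuous_on_table:
  "continuous_on UNIV (\<lambda>S :: ring_struct. radd S p)"
  "continuous_on UNIV (\<lambda>S :: ring_struct. rsub S p)"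
  "continuous_on UNIV (\<lambda>S :: ring_struct. rmul S p)"
  by (rule continuous_on_product_then_coordinatewise,
      intro continuous_on_fst continuous_on_snd continuous_on_id)+

lemmas continuous_on_ring_ops =
  continuous_on_nat_op[OF _ _ continuous_on_table(1)]
  continuous_on_nat_op[OF _ _ continuous_on_table(2)]
  continuous_on_nat_op[OF _ _ continuous_on_table(3)]
  continuous_on_rzero continuous_on_const

lemma continuous_on_eval: "continuous_on UNIV (\<lambda>S. eval S t)"
  by (induction t) (simp_all only: eval.simps, (intro continuous_on_ring_ops; assumption)+)

lemma continuous_on_word_value: "continuous_on UNIV (\<lambda>S. word_value S e y w)"
proof (induction w rule: rev_induct)
  case Nil
  show ?case unfolding word_value_Nil by (rule continuous_on_const)
next
  case (snoc L w)
  then show ?case unfolding word_value_snoc by (intro continuous_on_ring_ops)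
qed

text \<open>Conditions on finitely many values of the operations are both open, as needed to find a ring satisfying them in a
comeagre set, and closed, as needed to conclude from density that they hold on an open set.\<close>

definition clopen_prop :: "('a::topological_space \<Rightarrow> bool) \<Rightarrow> bool" where
  "clopen_prop P \<longleftrightarrow> open {x. P x} \<and> closed {x. P x}"

lemma clopen_prop_eq:
  fixes f g :: "'a::topological_space \<Rightarrow> nat"
  assumes "continuous_on UNIV f" "continuous_on UNIV g"
  shows "clopen_prop (\<lambda>x. f x = g x)"
proof -
  have "{x. f x = g x} = (\<Union>a. f -` {a} \<inter> g -` {a})" by auto
  also have "open \<dots>"
    by (intro open_UN ballI open_Int open_vimage open_discrete assms)
  finally show ?thesis
    using closed_Collect_eq[OF assms] by (simp add: clopen_prop_def)
qed

lemma clopen_prop_not: "clopen_prop P \<Longrightarrow> clopen_prop (\<lambda>x. \<not> P x)"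
  by (simp add: clopen_prop_def Collect_neg_eq open_Compl closed_Compl)

lemma clopen_prop_conj: "clopen_prop P \<Longrightarrow> clopen_prop Q \<Longrightarrow> clopen_prop (\<lambda>x. P x \<and> Q x)"
  by (simp add: clopen_prop_def open_Collect_conj closed_Collect_conj)

lemma clopen_prop_const: "clopen_prop (\<lambda>_. b)"
  by (cases b) (simp_all add: clopen_prop_def)

lemma clopen_prop_imp: "(b \<Longrightarrow> clopen_prop P) \<Longrightarrow> clopen_prop (\<lambda>x. b \<longrightarrow> P x)"
  by (cases b) (simp_all add: clopen_prop_const)

lemma clopen_prop_ball:
  assumes "finite A" "\<And>a. a \<in> A \<Longrightarrow> clopen_prop (P a)"
  shows "clopen_prop (\<lambda>x. \<forall>a\<in>A. P a x)"
proof -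
  have "{x. \<forall>a\<in>A. P a x} = (\<Inter>a\<in>A. {x. P a x})" by auto
  then show ?thesis
    using assms by (auto simp: clopen_prop_def intro!: open_INT closed_INT)
qed

lemma clopen_prop_iff_const: "clopen_prop P \<Longrightarrow> clopen_prop (\<lambda>x. P x \<longleftrightarrow> b)"
  by (cases b) (simp_all add: clopen_prop_not)

lemma clopen_prop_simulates: "finite Ls \<Longrightarrow> clopen_prop (\<lambda>S. simulates Ls S e y)"
  unfolding simulates_def
  by (intro clopen_prop_conj clopen_prop_ball clopen_prop_imp clopen_prop_not clopen_prop_eq
      continuous_on_ring_ops continuous_on_word_value; assumption)

lemma closed_Ring: "closed Ring"
proof -
  have "Ring = {S. (\<forall>a b c. radd S (radd S (a, b), c) = radd S (a, radd S (b, c))) \<and>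
     (\<forall>a b. radd S (a, b) = radd S (b, a)) \<and>
     (\<forall>a. radd S (rzero S, a) = a) \<and>
     (\<forall>a b. radd S (rsub S (a, b), b) = a) \<and>
     (\<forall>a b c. rmul S (rmul S (a, b), c) = rmul S (a, rmul S (b, c))) \<and>
     (\<forall>a b c. rmul S (radd S (a, b), c) = radd S (rmul S (a, c), rmul S (b, c))) \<and>
     (\<forall>a b c. rmul S (a, radd S (b, c)) = radd S (rmul S (a, b), rmul S (a, c)))}"
    by (auto simp: mem_Ring_iff)
  also have "closed \<dots>"
    by (intro closed_Collect_conj closed_Collect_all closed_Collect_eq continuous_on_ring_ops)
  finally show ?thesis .
qed

lemma completely_metrizable_ring_space: "completely_metrizable_space ring_space"
proof -
  have nat: "completely_metrizable_space (euclidean :: nat topology)"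
    by (metis completely_metrizable_space_discrete_topology discrete_topology_unique openin_discrete_topology
        open_discrete open_openin topspace_euclidean subset_UNIV)
  have "completely_metrizable_space (product_topology (\<lambda>_ :: nat \<times> nat. euclidean :: nat topology) UNIV)"
    by (rule completely_metrizable_space_product_topology[THEN iffD2]) (simp add: nat)
  then have "completely_metrizable_space (euclidean :: (nat \<times> nat \<Rightarrow> nat) topology)"
    by (simp add: euclidean_product_topology)
  with nat have "completely_metrizable_space (euclidean :: ring_struct topology)"
    by (simp add: completely_metrizable_space_prod_topology flip: prod_topology_euclidean)
  then show ?thesis
    unfolding ring_space_def using closed_Ring
    by (simp add: completely_metrizable_space_closedin)
qed

text \<open>Together with the nowhere dense sets in the complement of \<open>C\<close>, the sets \<open>F i\<close> cover a nonempty open set, so they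
cannot all have empty interior.  With \<open>I\<close> empty this says that a comeagre set meets all nonempty open sets.\<close>

lemma comeagre_in_ring_space_cover:
  assumes C: "comeagre_in ring_space C" and W: "open W" "W \<inter> Ring \<noteq> {}"
    and I: "countable I" and F: "\<And>i. i \<in> I \<Longrightarrow> closed (F i)" and cov: "C \<inter> W \<subseteq> (\<Union>i\<in>I. F i)"
  obtains i U where "i \<in> I" "open U" "U \<inter> Ring \<noteq> {}" "U \<inter> Ring \<subseteq> F i"
proof -
  obtain N :: "nat \<Rightarrow> ring_struct set" where N: "\<And>n. nowhere_dense_in ring_space (N n)"
    and CN: "topspace ring_space - C = (\<Union>n. N n)"
    using C unfolding comeagre_in_def meagre_in_def by blast
  have top: "topspace ring_space = Ring" by (simp add: ring_space_def)
  define G where "G = range (\<lambda>n. ring_space closure_of N n) \<union> (\<lambda>i. Ring \<inter> F i) ` I"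
  have "countable G" using I by (simp add: G_def)
  have clo: "closedin ring_space T" if "T \<in> G" for T
    using that F by (auto simp: G_def ring_space_def closedin_closed_Int)
  have "W \<inter> Ring \<subseteq> \<Union>G"
  proof
    fix S assume S: "S \<in> W \<inter> Ring"
    show "S \<in> \<Union>G"
    proof (cases "S \<in> C")
      case True
      then show ?thesis using S cov by (auto simp: G_def)
    next
      case False
      then obtain n where "S \<in> N n" using S CN top by blast
      moreover have "N n \<subseteq> ring_space closure_of N n"
        using N[of n] by (simp add: nowhere_dense_in_def closure_of_subset)
      ultimately show ?thesis by (auto simp: G_def)
    qed
  qed
  moreover have "openin ring_space (W \<inter> Ring)"
    using W(1) by (auto simp: ring_space_def openin_open)
  ultimately have "ring_space interior_of \<Union>G \<noteq> {}"
    using W(2) interior_of_maximal by blast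
  then have "\<exists>T\<in>G. ring_space interior_of T \<noteq> {}"
    using Baire_category_alt[of ring_space G] completely_metrizable_ring_space \<open>countable G\<close> clo by blast
  then obtain i where i: "i \<in> I" "ring_space interior_of (Ring \<inter> F i) \<noteq> {}"
    using N by (auto simp: G_def nowhere_dense_in_def)
  have "openin ring_space (ring_space interior_of (Ring \<inter> F i))" by simp
  then obtain U where U: "open U" "ring_space interior_of (Ring \<inter> F i) = Ring \<inter> U"
    unfolding ring_space_def openin_open by blast
  moreover have "ring_space interior_of (Ring \<inter> F i) \<subseteq> Ring \<inter> F i" by (rule interior_of_subset)
  ultimately show thesis using i by (intro that[of i U]) auto
qed

text \<open>Membership in a neighbourhood for the product topology is guaranteed by finitely many coordinates.\<close>

lemma open_fun_finitely_determined:
  fixes a :: "'i \<Rightarrow> 'b::topological_space"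
  assumes "open A" "a \<in> A"
  obtains K where "finite K" "\<And>b. (\<And>k. k \<in> K \<Longrightarrow> b k = a k) \<Longrightarrow> b \<in> A"
proof -
  from assms(1) have "openin (product_topology (\<lambda>_. euclidean) UNIV) A" by (simp add: open_fun_def)
  from product_topology_open_contains_basis[OF this assms(2)] obtain X where X:
    "a \<in> (\<Pi>\<^sub>E i\<in>UNIV. X i)" "finite {i. X i \<noteq> UNIV}" "(\<Pi>\<^sub>E i\<in>UNIV. X i) \<subseteq> A"
    by auto
  have "b \<in> A" if "\<And>k. k \<in> {i. X i \<noteq> UNIV} \<Longrightarrow> b k = a k" for b
  proof -
    have "b i \<in> X i" for i using that[of i] X(1) by (cases "X i = UNIV") (auto simp: PiE_iff)
    then show ?thesis using X(3) by auto
  qed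
  with X(2) show thesis by (rule that)
qed

text \<open>The required equations are finitely many entries of the tables for addition, subtraction and multiplication.\<close>

lemma open_ring_finitely_presented:
  assumes U: "open U" "S \<in> U" and S: "S \<in> Ring"
  obtains E where "models S (set E)" "\<And>S'. S' \<in> Ring \<Longrightarrow> models S' (set E) \<Longrightarrow> S' \<in> U"
proof -
  obtain a s m z where S_eq: "S = (a, s, m, z)" by (cases S)
  obtain A U1 where "open A" "open U1" "(a, s, m, z) \<in> A \<times> U1" "A \<times> U1 \<subseteq> U"
    using U unfolding S_eq by (rule open_prod_elim)
  then have A: "open A" "a \<in> A" and U1: "open U1" "(s, m, z) \<in> U1" "A \<times> U1 \<subseteq> U" by auto
  obtain B U2 where "open B" "open U2" "(s, m, z) \<in> B \<times> U2" "B \<times> U2 \<subseteq> U1"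
    using U1(1,2) by (rule open_prod_elim)
  then have B: "open B" "s \<in> B" and U2: "open U2" "(m, z) \<in> U2" "B \<times> U2 \<subseteq> U1" by auto
  obtain M Z where "open M" "open Z" "(m, z) \<in> M \<times> Z" "M \<times> Z \<subseteq> U2"
    using U2(1,2) by (rule open_prod_elim)
  then have M: "open M" "m \<in> M" and Z: "z \<in> Z" "M \<times> Z \<subseteq> U2" by auto
  obtain KA where KA: "finite KA" "\<And>b. (\<And>k. k \<in> KA \<Longrightarrow> b k = a k) \<Longrightarrow> b \<in> A"
    using open_fun_finitely_determined[OF A] by blast
  obtain KB where KB: "finite KB" "\<And>b. (\<And>k. k \<in> KB \<Longrightarrow> b k = s k) \<Longrightarrow> b \<in> B"
    using open_fun_finitely_determined[OF B] by blast
  obtain KM where KM: "finite KM" "\<And>b. (\<And>k. k \<in> KM \<Longrightarrow> b k = m k) \<Longrightarrow> b \<in> M"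
    using open_fun_finitely_determined[OF M] by blast
  define T where "T = {(Zero, Var z)} \<union>
    (\<lambda>(i, j). (Add (Var i) (Var j), Var (a (i, j)))) ` KA \<union>
    (\<lambda>(i, j). (Sub (Var i) (Var j), Var (s (i, j)))) ` KB \<union>
    (\<lambda>(i, j). (Mul (Var i) (Var j), Var (m (i, j)))) ` KM"
  have "finite T" using KA KB KM by (simp add: T_def)
  then obtain E where E: "set E = T" using finite_list by blast
  have iff: "models S' T \<longleftrightarrow> rzero S' = z \<and> (\<forall>k\<in>KA. radd S' k = a k) \<and> (\<forall>k\<in>KB. rsub S' k = s k) \<and>
      (\<forall>k\<in>KM. rmul S' k = m k)" if "S' \<in> Ring" for S'
    using eval_Zero[OF that] by (auto simp: models_def T_def ball_Un split_beta)
  have "models S T" using iff[OF S] by (simp add: S_eq)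
  moreover have "S' \<in> U" if S': "S' \<in> Ring" "models S' T" for S'
  proof -
    have "rzero S' = z" using iff[OF S'(1)] S'(2) by blast
    then obtain a' s' m' where "S' = (a', s', m', z)" by (metis prod.collapse)
    with iff[OF S'(1)] S'(2) KA(2) KB(2) KM(2) have "a' \<in> A" "s' \<in> B" "m' \<in> M" by auto
    with \<open>S' = (a', s', m', z)\<close> U1(3) U2(3) Z show ?thesis by blast
  qed
  ultimately show thesis using that[of E] E by simp
qed

lemma word_value_cong: "(\<And>L. L \<in> set w \<Longrightarrow> y L = y' L) \<Longrightarrow> word_value S e y w = word_value S e y' w"
  unfolding word_value_def by (intro foldl_cong) auto

lemma simulates_cong:
  assumes cl: "closed_instrs Ls" and y: "\<And>L. L \<in> Ls \<Longrightarrow> y L = y' L"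
  shows "simulates Ls S e y \<longleftrightarrow> simulates Ls S e y'"
proof -
  have "word_value S e y w = word_value S e y' w" if "set w \<subseteq> Ls" for w
    using that y by (intro word_value_cong) auto
  then have "word_value S e y (on_zero L) = word_value S e y' (on_zero L)"
    "word_value S e y (on_suc L) = word_value S e y' (on_suc L)" if "L \<in> Ls" for L
    using closed_instrsD(4,5)[OF cl that] by blast+
  then show ?thesis
    using y closed_instrsD(1-3)[OF cl] by (simp add: simulates_def)
qed

lemma simulates_hom:
  assumes f: "inj f" "\<And>a b. f (rmul R (a, b)) = rmul S (f a, f b)" "f (rzero R) = rzero S"
  shows "simulates Ls R e y \<longleftrightarrow> simulates Ls S (f e) (f \<circ> y)"
proof -
  have word: "word_value S (f e) (f \<circ> y) w = f (word_value R e y w)" for w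
    by (induction w rule: rev_induct) (simp_all add: word_value_snoc f(2))
  show ?thesis
    by (simp add: simulates_def word inj_eq[OF f(1)] flip: f(2,3))
qed

lemma eval_pulse_hom:
  assumes f: "\<And>a b. f (rmul R (a, b)) = rmul S (f a, f b)"
  shows "eval S (pulse n (f p) (f i) (f c)) = f (eval R (pulse n p i c))"
proof -
  have "eval S (((\<lambda>s. Mul s (Var (f i))) ^^ n) (Var (f p))) = f (eval R (((\<lambda>s. Mul s (Var i)) ^^ n) (Var p)))"
    by (induction n) (simp_all add: f)
  then show ?thesis by (simp add: pulse_def f)
qed

lemma isomorphicE:
  assumes "isomorphic R S"
  obtains f where "bij f" "\<And>a b. f (rmul R (a, b)) = rmul S (f a, f b)" "f (rzero R) = rzero S"
  using assms by (cases "(R, S)" rule: isomorphic.cases) auto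

text \<open>The set \<open>I\<close> consists of the candidates for \<open>e\<close> and for the elements assigned to the instructions of the diagonal
program, normalized outside these instructions to make \<open>I\<close> countable.\<close>

theorem corollary4p4:
  shows "\<not> (\<exists>R. generic_ring R)"
proof
  assume "\<exists>R. generic_ring R"
  then obtain R where "generic_ring R" ..
  define C where "C = {S \<in> Ring. isomorphic R S}"
  have C: "comeagre_in ring_space C"
    using \<open>generic_ring R\<close> by (simp add: generic_ring_def C_def)
  obtain L where L: "\<And>S e y E x. S \<in> Ring \<Longrightarrow> simulates (instrs_of L) S e y \<Longrightarrow> models S (set E) \<Longrightarrow>
      x = (E, y Push, y Inc, y L) \<Longrightarrow>
      (probe x, Zero) \<notin> Th (set E) \<and>
      (\<forall>i j. (Var i, Var j) \<in> Th (insert (probe x, Zero) (set E)) \<longrightarrow> i = j)"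
    by (rule rosser_instr) (rule that)
  define Ls where "Ls = instrs_of L"
  have cl: "closed_instrs Ls" and fin: "finite Ls"
    by (simp_all add: Ls_def closed_instrs_of finite_instrs_of)
  have "L \<in> Ls" by (simp add: Ls_def instrs_of_def self_sub_instrs)
  obtain S0 e0 y0 where S0: "S0 \<in> Ring" "simulates UNIV S0 e0 y0"
    by (rule ring_simulating_all_instrs)
  then have "simulates Ls S0 e0 y0" by (simp add: simulates_def)
  define W where "W = (\<Union>e y. {S. simulates Ls S e y})"
  have "open W"
    unfolding W_def using clopen_prop_simulates[OF fin]
    by (intro open_UN ballI) (simp add: clopen_prop_def)
  moreover have "W \<inter> Ring \<noteq> {}" using S0 \<open>simulates Ls S0 e0 y0\<close> by (auto simp: W_def)
  ultimately have "C \<inter> W \<noteq> {}"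
    using comeagre_in_ring_space_cover[OF C, of W "{} :: unit set" "\<lambda>_. {}"] by auto
  then obtain R' e' y' where "R' \<in> C" "simulates Ls R' e' y'" by (auto simp: W_def)
  then have "isomorphic R R'" by (simp add: C_def)
  then obtain g where g: "bij g" "\<And>a b. g (rmul R (a, b)) = rmul R' (g a, g b)" "g (rzero R) = rzero R'"
    by (rule isomorphicE) (rule that)
  \<comment> \<open>The simulation is pulled back along the isomorphism from \<open>R\<close>.\<close>
  define e y where "e = inv g e'" and "y = inv g \<circ> y'"
  have "g e = e'" "g \<circ> y = y'"
    using bij_is_surj[OF g(1)] by (simp_all add: e_def y_def surj_f_inv_f fun_eq_iff)
  then have R_sim: "simulates Ls R e y"
    using simulates_hom[OF bij_is_inj[OF g(1)] g(2,3)] \<open>simulates Ls R' e' y'\<close> by simp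
  define p :: "ring_struct \<Rightarrow> (instr \<Rightarrow> nat) \<Rightarrow> nat \<Rightarrow> nat"
    where "p S z n = eval S (pulse n (z Push) (z Inc) (z L))" for S z n
  define I where "I = (UNIV :: nat set) \<times> (\<Pi>\<^sub>E L\<in>Ls. (UNIV :: nat set))"
  \<comment> \<open>The rings in which \<open>i\<close> simulates the machine and gives the same answers as the simulation in \<open>R\<close>.\<close>
  define F where "F i = {S. simulates Ls S (fst i) (snd i)} \<inter>
      (\<Inter>n. {S. p S (snd i) n = rzero S \<longleftrightarrow> p R y n = rzero R})" for i
  have cI: "countable I"
    unfolding I_def by (intro countable_SIGMA countable_PiE fin) auto
  have cF: "closed (F i)" if "i \<in> I" for i
  proof -
    have "clopen_prop (\<lambda>S. p S (snd i) n = rzero S \<longleftrightarrow> p R y n = rzero R)" for n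
      unfolding p_def
      by (intro clopen_prop_iff_const clopen_prop_eq continuous_on_eval continuous_on_rzero)
    then show ?thesis
      using clopen_prop_simulates[OF fin]
      unfolding F_def clopen_prop_def by (intro closed_Int closed_INT ballI) simp_all
  qed
  have cov: "C \<inter> UNIV \<subseteq> (\<Union>i\<in>I. F i)"
  proof
    fix S assume "S \<in> C \<inter> UNIV"
    then have "isomorphic R S" by (simp add: C_def)
    then obtain f where f: "bij f" "\<And>a b. f (rmul R (a, b)) = rmul S (f a, f b)" "f (rzero R) = rzero S"
      by (rule isomorphicE) (rule that)
    define z where "z = restrict (f \<circ> y) Ls"
    have z: "z L = f (y L)" if "L \<in> Ls" for L using that by (simp add: z_def)
    have "simulates Ls S (f e) z"
      using simulates_hom[OF bij_is_inj[OF f(1)] f(2,3)] R_sim simulates_cong[OF cl, of z "f \<circ> y"]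
      by (simp add: z_def)
    moreover have "p S z n = rzero S \<longleftrightarrow> p R y n = rzero R" for n
      using eval_pulse_hom[of f R S, OF f(2)] bij_is_inj[OF f(1)] closed_instrsD(1,2)[OF cl] \<open>L \<in> Ls\<close>
      by (simp add: p_def z f(3)[symmetric] inj_eq)
    moreover have "(f e, z) \<in> I" by (simp add: I_def z_def)
    ultimately have "(f e, z) \<in> I" "S \<in> F (f e, z)" by (simp_all add: F_def)
    then show "S \<in> (\<Union>i\<in>I. F i)" by blast
  qed
  have "UNIV \<inter> Ring \<noteq> {}" using S0(1) by blast
  then obtain i U where U: "open U" "U \<inter> Ring \<noteq> {}" "U \<inter> Ring \<subseteq> F i"
    by (rule comeagre_in_ring_space_cover[OF C open_UNIV _ cI cF cov]) (assumption, rule that)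
  obtain d z where i: "i = (d, z)" by (cases i)
  obtain S where S: "S \<in> Ring" "S \<in> U" using U(2) by blast
  obtain E where E: "models S (set E)" "\<And>S'. S' \<in> Ring \<Longrightarrow> models S' (set E) \<Longrightarrow> S' \<in> U"
    using open_ring_finitely_presented[OF U(1) S(2,1)] by blast
  have "S \<in> F i" using U(3) S by blast
  then have "simulates (instrs_of L) S d z" by (simp add: F_def i Ls_def)
  define x where "x = (E, z Push, z Inc, z L)"
  have indep: "(probe x, Zero) \<notin> Th (set E)"
    "\<And>i j. (Var i, Var j) \<in> Th (insert (probe x, Zero) (set E)) \<Longrightarrow> i = j"
    using L[OF S(1) \<open>simulates (instrs_of L) S d z\<close> E(1) x_def] by blast+
  \<comment> \<open>The probe is one of the pulses on which all rings in \<open>F i\<close> agree.\<close>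
  have dec: "eval S' (probe x) = rzero S' \<longleftrightarrow> p R y (encode x) = rzero R"
    if "S' \<in> Ring" "models S' (set E)" for S'
  proof -
    have "S' \<in> F i" using U(3) E(2)[OF that] that(1) by blast
    then show ?thesis by (simp add: F_def i p_def probe_def x_def)
  qed
  obtain S1 S2 where "S1 \<in> Ring" "models S1 (set E)" "eval S1 (probe x) = rzero S1"
    "S2 \<in> Ring" "models S2 (set E)" "eval S2 (probe x) \<noteq> rzero S2"
    by (rule undecided_probe[OF S(1) E(1) indep]) (assumption, rule that)
  with dec show False by blast
qed

end
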